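(* There is an absolute constant $C>0$ such that the following holds. Let $A$ be the (random) adjacency matrix of a random graph on $n$ vertices drawn from the inhomogeneous Erdős–Rényi model $G(n,(p_{ij}))$, and let $d=\max_{i,j} n p_{ij}$. For any $r\ge 1$, the following holds with probability at least $1-n^{-r}$ (simultaneously for all choices of the vertex subset and of the reweighting below). Consider any subset $V_0\subset[n]$ consisting of at most $10n/d$ vertices, and reduce the weights of the edges incident to the vertices in $V_0$ in an arbitrary way. Let $A'$ be the adjacency matrix of the resulting weighted graph, and let $d'$ be the maximal degree of the resulting graph, i.e. $d'=\max_i\sum_j A'_{ij}$. Then $$\|A'-\mathbb{E}A\|\le C r^{3/2}\big(\sqrt{d}+\sqrt{d'}\big).$$ Moreover, the same bound holds with $d'$ being instead the maximal squared $\ell_2$ norm of the rows of $A'$, i.e. $d'=\max_i\sum_j (A'_{ij})^2$.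
   Context: $[n]=\{1,\dots,n\}$. The inhomogeneous Erdős–Rényi model $G(n,(p_{ij}))$: $(p_{ij})$ is a symmetric $n\times n$ matrix with entries in $[0,1]$, and edges of an undirected graph on the vertex set $[n]$ are formed independently, the edge $\{i,j\}$ being present with probability $p_{ij}$. Thus $A$ is a symmetric random matrix with entries in $\{0,1\}$, with $A_{ij}$, $i\le j$, independent and $\mathbb{P}\{A_{ij}=1\}=p_{ij}$ (loops may be excluded by taking $p_{ii}=0$); $\mathbb{E}A=(p_{ij})$. Reducing the weights of the edges incident to $V_0$ means: $A'$ is any symmetric matrix with $0\le A'_{ij}\le A_{ij}$ for all $i,j$, and $A'_{ij}=A_{ij}$ whenever $i\notin V_0$ and $j\notin V_0$. The reweighting may depend on $A$. $\|\cdot\|$ denotes the spectral norm ($\ell_2\to\ell_2$ operator norm). *)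

theory Defs
  imports "HOL-Probability.Probability" "HOL-Probability.Product_PMF"
begin

(* An n x n matrix is a function nat => nat => real of which only the entries indexed by
   {1..n} matter; n is a number, not a type, so that constants can be uniform in n. *)

definition edge_probs :: "nat \<Rightarrow> (nat \<Rightarrow> nat \<Rightarrow> real) \<Rightarrow> bool" where
  "edge_probs n p \<longleftrightarrow>
     (\<forall>i\<in>{1..n}. \<forall>j\<in>{1..n}. 0 \<le> p i j \<and> p i j \<le> 1 \<and> p i j = p j i)"

(* Edges, loops included, are represented by the pairs (i, j) with i <= j. *)
definition edge_slots :: "nat \<Rightarrow> (nat \<times> nat) set" where
  "edge_slots n = {(i, j). i \<in> {1..n} \<and> j \<in> {1..n} \<and> i \<le> j}"

definition adj_matrix :: "nat \<Rightarrow> (nat \<times> nat \<Rightarrow> bool) \<Rightarrow> nat \<Rightarrow> nat \<Rightarrow> real" where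
  "adj_matrix n E i j =
     (if i \<in> {1..n} \<and> j \<in> {1..n} then of_bool (E (min i j, max i j)) else 0)"

(* The distribution of the adjacency matrix of the inhomogeneous Erdos-Renyi graph.  The model
   is given by its law, so that a constant independent of n and p is also independent of the
   underlying probability space. *)
definition inhom_ER :: "nat \<Rightarrow> (nat \<Rightarrow> nat \<Rightarrow> real) \<Rightarrow> (nat \<Rightarrow> nat \<Rightarrow> real) pmf" where
  "inhom_ER n p =
     map_pmf (adj_matrix n) (Pi_pmf (edge_slots n) False (\<lambda>(i, j). bernoulli_pmf (p i j)))"

definition mean_matrix :: "(nat \<Rightarrow> nat \<Rightarrow> real) pmf \<Rightarrow> nat \<Rightarrow> nat \<Rightarrow> real" where
  "mean_matrix G i j = measure_pmf.expectation G (\<lambda>A. A i j)"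

definition max_expected_degree :: "nat \<Rightarrow> (nat \<Rightarrow> nat \<Rightarrow> real) \<Rightarrow> real" where
  "max_expected_degree n p = Max {real n * p i j | i j. i \<in> {1..n} \<and> j \<in> {1..n}}"

definition max_degree :: "nat \<Rightarrow> (nat \<Rightarrow> nat \<Rightarrow> real) \<Rightarrow> real" where
  "max_degree n M = Max {(\<Sum>j\<in>{1..n}. M i j) | i. i \<in> {1..n}}"

definition max_row_norm_sq :: "nat \<Rightarrow> (nat \<Rightarrow> nat \<Rightarrow> real) \<Rightarrow> real" where
  "max_row_norm_sq n M = Max {(\<Sum>j\<in>{1..n}. (M i j)\<^sup>2) | i. i \<in> {1..n}}"

definition spectral_norm :: "nat \<Rightarrow> (nat \<Rightarrow> nat \<Rightarrow> real) \<Rightarrow> real" where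
  "spectral_norm n M =
     (SUP x\<in>{x. L2_set x {1..n} \<le> 1}. L2_set (\<lambda>i. \<Sum>j\<in>{1..n}. M i j * x j) {1..n})"

definition reweighting ::
  "nat \<Rightarrow> nat set \<Rightarrow> (nat \<Rightarrow> nat \<Rightarrow> real) \<Rightarrow> (nat \<Rightarrow> nat \<Rightarrow> real) \<Rightarrow> bool" where
  "reweighting n V0 A A' \<longleftrightarrow>
     (\<forall>i\<in>{1..n}. \<forall>j\<in>{1..n}.
        A' i j = A' j i \<and> 0 \<le> A' i j \<and> A' i j \<le> A i j \<and>
        (i \<notin> V0 \<and> j \<notin> V0 \<longrightarrow> A' i j = A i j))"

lemma finite_edge_slots [simp]: "finite (edge_slots n)"
  by (rule finite_subset[of _ "{1..n} \<times> {1..n}"]) (auto simp: edge_slots_def)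

lemma adj_matrix_sym: "adj_matrix n E i j = adj_matrix n E j i"
  by (simp add: adj_matrix_def min.commute max.commute conj_commute)

lemma inhom_ER_entry:
  assumes "edge_probs n p" "i \<in> {1..n}" "j \<in> {1..n}"
  shows "map_pmf (\<lambda>A. A i j) (inhom_ER n p) = map_pmf of_bool (bernoulli_pmf (p i j))"
proof -
  have *: "(min i j, max i j) \<in> edge_slots n"
    using assms by (auto simp: edge_slots_def min_def max_def)
  have p: "p (min i j) (max i j) = p i j"
    using assms by (auto simp: edge_probs_def min_def max_def)
  have "map_pmf (\<lambda>A. A i j) (inhom_ER n p) =
     map_pmf of_bool (map_pmf (\<lambda>E. E (min i j, max i j))
       (Pi_pmf (edge_slots n) False (\<lambda>(i, j). bernoulli_pmf (p i j))))"
    using assms by (simp add: inhom_ER_def map_pmf_comp adj_matrix_def)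
  also have "\<dots> = map_pmf of_bool (bernoulli_pmf (p i j))"
    using * p by (subst Pi_pmf_component) auto
  finally show ?thesis .
qed

lemma inhom_ER_mean:
  assumes "edge_probs n p" "i \<in> {1..n}" "j \<in> {1..n}"
  shows "mean_matrix (inhom_ER n p) i j = p i j"
proof -
  have "mean_matrix (inhom_ER n p) i j =
      measure_pmf.expectation (map_pmf (\<lambda>A. A i j) (inhom_ER n p)) (\<lambda>x. x)"
    by (simp add: mean_matrix_def)
  also have "\<dots> = p i j"
    unfolding inhom_ER_entry[OF assms] using assms by (simp add: edge_probs_def)
  finally show ?thesis .
qed

lemma inhom_ER_indep:
  "prob_space.indep_vars (measure_pmf (inhom_ER n p)) (\<lambda>_. count_space UNIV)
     (\<lambda>(i, j) A. A i j) (edge_slots n)"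
proof -
  let ?P = "Pi_pmf (edge_slots n) False (\<lambda>(i, j). bernoulli_pmf (p i j))"
  have "prob_space.indep_vars (measure_pmf ?P) (\<lambda>_. count_space UNIV)
      (\<lambda>e E. (of_bool (E e) :: real)) (edge_slots n)"
    by (rule prob_space.indep_vars_compose2[OF _ indep_vars_Pi_pmf])
       (auto simp: measure_pmf.prob_space_axioms)
  also have "?this \<longleftrightarrow> prob_space.indep_vars (measure_pmf ?P) (\<lambda>_. count_space UNIV)
      (\<lambda>e E. (case e of (i, j) \<Rightarrow> \<lambda>A. A i j) (adj_matrix n E)) (edge_slots n)"
    by (rule prob_space.indep_vars_cong)
       (auto simp: measure_pmf.prob_space_axioms adj_matrix_def edge_slots_def min_def max_def fun_eq_iff)
  finally have ind: "prob_space.indep_vars (measure_pmf ?P) (\<lambda>_. count_space UNIV)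
      (\<lambda>e E. (case e of (i, j) \<Rightarrow> \<lambda>A. A i j) (adj_matrix n E)) (edge_slots n)" .
  let ?X = "\<lambda>(i, j) A. A i j :: real"
  show ?thesis
    unfolding prob_space.indep_vars_def2[OF measure_pmf.prob_space_axioms]
  proof (intro conjI ballI prob_space.indep_setsI measure_pmf.prob_space_axioms)
    fix S J
    assume J: "J \<noteq> {}" "J \<subseteq> edge_slots n" "finite J"
      and S: "\<forall>e\<in>J. S e \<in> {?X e -` B \<inter> space (measure_pmf (inhom_ER n p)) |B.
                 B \<in> sets (count_space UNIV)}"
    obtain B where B: "\<And>e. e \<in> J \<Longrightarrow> S e = ?X e -` B e"
      using S by (simp add: Bex_def) metis
    have "measure_pmf.prob ?P (\<Inter>e\<in>J. (\<lambda>E. ?X e (adj_matrix n E)) -` B e \<inter> space ?P)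
        = (\<Prod>e\<in>J. measure_pmf.prob ?P ((\<lambda>E. ?X e (adj_matrix n E)) -` B e \<inter> space ?P))"
      by (rule prob_space.indep_varsD[OF measure_pmf.prob_space_axioms ind J(1,3,2)]) simp
    then show "measure_pmf.prob (inhom_ER n p) (\<Inter>e\<in>J. S e)
        = (\<Prod>e\<in>J. measure_pmf.prob (inhom_ER n p) (S e))"
      using B by (simp add: inhom_ER_def vimage_INT vimage_comp comp_def)
  qed auto
qed

end

theory Submission
  imports Defs
begin

text \<open>
  Since the entries of \<open>A'\<close> lie in \<open>[0, 1]\<close>, the bound with squared row norms implies the one with
  degrees.  By rounding, the spectral norm is at most the maximum of the bilinear form
  \<open>(1 / n) * (\<Sum>i j. M i j * k i * l j)\<close> over integer vectors with squared norm at most \<open>4 * n\<close>;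
  there are only \<open>exp (O(n))\<close> of them.

  Let \<open>H\<close> be the set of vertices of degree above \<open>80 * r * d\<close>.  With high probability \<open>H\<close> has fewer
  than \<open>n / d\<^sup>2\<close> elements and all vertex sets of that size span sparse subgraphs, so the edges meeting
  \<open>H\<close> can be oriented with out-degrees \<open>O(r)\<close>.  By Cauchy--Schwarz, any reweighting of these edges
  contributes \<open>O(sqrt r)\<close> times the maximal row norm.  Away from \<open>H\<close> the pairs \<open>(i, j)\<close> are split as in
  the argument of Feige and Ofek.  Light pairs, \<open>\<bar>k i * l j\<bar> \<le> sqrt d\<close>, are controlled by an exponential
  moment and a union bound; the set of vectors is closed under restriction of the support, and this
  absorbs the reweighting on \<open>V0\<close>.  Heavy pairs are controlled by the discrepancy property of the edge
  counts and the degree bound.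
\<close>

section \<open>Exponential moments\<close>

text \<open>The obstacle is that after an arbitrary reweighting only the row norms of
  \<open>A'\<close> are under control, while a vertex of \<open>H\<close> may have a huge degree in
  \<open>A\<close>. Orientations help because Cauchy--Schwarz needs few edges at one endpoint only:
  the out-degree in \<open>A\<close> is spent on one vector, the row norms of \<open>A'\<close> on
  the other. The size \<open>n / d^2\<close> comes from sparsity: \<open>s\<close> vertices span
  about \<open>d s^2 / n\<close> edges in the mean, and \<open>s <= n / d^2\<close> makes this at
  most \<open>s sqrt (s / n)\<close>. A larger multiple of \<open>s\<close> edges exceeds the mean
  by a factor of order \<open>sqrt (n / s)\<close>, whose logarithm matches the entropy per vertex.
  The size \<open>n / d\<close> of \<open>V0\<close> comes from light pairs: there the reweighting
  error is at most the sum over \<open>A\<close> in the rows and columns of \<open>V0\<close>. Its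
  random part is another instance of the light bound; its mean is of order
  \<open>d sqrt (n card V0)\<close>, which is \<open>n sqrt d\<close> at
  \<open>card V0 = n / d\<close>. All losses in \<open>r\<close> are at most linear, below the
  permitted power 3/2.\<close>

lemma exp_le_quadratic:
  fixes x :: real
  assumes "\<bar>x\<bar> \<le> 1"
  shows "exp x \<le> 1 + x + x\<^sup>2"
proof (cases "0 \<le> x")
  case True
  then show ?thesis using exp_bound[of x] assms by auto
next
  case False
  define y where "y = - x"
  have y: "0 < y" "y \<le> 1" using False assms by (auto simp: y_def)
  \<comment> \<open>The product equals \<open>1 + y^3\<close>.\<close>
  have "1 \<le> (1 + y) * (1 - y + y\<^sup>2)"
    using y by (simp add: algebra_simps power2_eq_square)
  also have "\<dots> \<le> exp y * (1 - y + y\<^sup>2)"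
    using y by (intro mult_right_mono) (auto simp: exp_ge_add_one_self)
  finally have "exp (- y) * 1 \<le> exp (- y) * (exp y * (1 - y + y\<^sup>2))"
    by (intro mult_left_mono) auto
  also have "\<dots> = 1 - y + y\<^sup>2" by (simp flip: mult.assoc exp_add)
  finally show ?thesis by (simp add: y_def)
qed

text \<open>Only the slots \<open>i <= j\<close> carry independent variables, so coefficients on the
  full grid must be folded onto them; an off-diagonal slot receives two.\<close>

lemma sum_grid_eq_sum_slots:
  fixes h :: "nat \<Rightarrow> nat \<Rightarrow> real"
  shows "(\<Sum>i\<in>{1..n}. \<Sum>j\<in>{1..n}. h i j) =
    (\<Sum>e\<in>edge_slots n. if fst e = snd e then h (fst e) (snd e)
       else h (fst e) (snd e) + h (snd e) (fst e))"
proof -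
  let ?U = "{(i, j). i \<in> {1..n} \<and> j \<in> {1..n} \<and> i < j}"
  let ?L = "{(i, j). i \<in> {1..n} \<and> j \<in> {1..n} \<and> j < i}"
  let ?D = "{(i, j). i \<in> {1..n} \<and> j \<in> {1..n} \<and> i = j}"
  have fin: "finite ?U" "finite ?L" "finite ?D"
    by (rule finite_subset[of _ "{1..n} \<times> {1..n}"], auto)+
  have "(\<Sum>i\<in>{1..n}. \<Sum>j\<in>{1..n}. h i j) = (\<Sum>(i, j)\<in>{1..n} \<times> {1..n}. h i j)"
    by (simp add: sum.cartesian_product)
  also have "{1..n} \<times> {1..n} = ?D \<union> (?U \<union> ?L)" by auto
  also have "(\<Sum>(i, j)\<in>\<dots>. h i j) =
      (\<Sum>(i, j)\<in>?D. h i j) + ((\<Sum>(i, j)\<in>?U. h i j) + (\<Sum>(i, j)\<in>?L. h i j))"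
    using fin by (subst sum.union_disjoint, simp, simp, force,
      subst sum.union_disjoint, simp, simp, force, simp)
  also have "(\<Sum>(i, j)\<in>?L. h i j) = (\<Sum>(i, j)\<in>?U. h j i)"
    by (rule sum.reindex_bij_witness[of _ prod.swap prod.swap]) auto
  also have "(\<Sum>(i, j)\<in>?D. h i j) + ((\<Sum>(i, j)\<in>?U. h i j) + (\<Sum>(i, j)\<in>?U. h j i)) =
      (\<Sum>(i, j)\<in>?D. h i j) + (\<Sum>(i, j)\<in>?U. h i j + h j i)"
    by (simp add: sum.distrib case_prod_unfold)
  also have "\<dots> = (\<Sum>e\<in>?D. if fst e = snd e then h (fst e) (snd e)
       else h (fst e) (snd e) + h (snd e) (fst e)) +
      (\<Sum>e\<in>?U. if fst e = snd e then h (fst e) (snd e)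
       else h (fst e) (snd e) + h (snd e) (fst e))"
    by (intro arg_cong2[where f = "(+)"] sum.cong) auto
  also have "\<dots> = (\<Sum>e\<in>?D \<union> ?U. if fst e = snd e then h (fst e) (snd e)
       else h (fst e) (snd e) + h (snd e) (fst e))"
    using fin by (intro sum.union_disjoint[symmetric]) auto
  also have "?D \<union> ?U = edge_slots n" by (auto simp: edge_slots_def)
  finally show ?thesis .
qed

lemma finite_set_inhom_ER: "finite (set_pmf (inhom_ER n p))"
proof -
  have "set_pmf (Pi_pmf (edge_slots n) False (\<lambda>(i, j). bernoulli_pmf (p i j)))
      \<subseteq> PiE_dflt (edge_slots n) False (\<lambda>_. UNIV)"
    using set_Pi_pmf_subset'[of "edge_slots n" False "\<lambda>(i, j). bernoulli_pmf (p i j)"]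
    by (fastforce simp: PiE_dflt_def)
  moreover have "finite (PiE_dflt (edge_slots n) False (\<lambda>_. UNIV :: bool set))"
    by (intro finite_PiE_dflt) auto
  ultimately show ?thesis
    unfolding inhom_ER_def by (auto intro: finite_subset)
qed

lemma integrable_inhom_ER [simp]:
  fixes f :: "(nat \<Rightarrow> nat \<Rightarrow> real) \<Rightarrow> real"
  shows "integrable (measure_pmf (inhom_ER n p)) f"
  by (rule integrable_measure_pmf_finite[OF finite_set_inhom_ER])

text \<open>Each slot contributes a Bernoulli factor \<open>1 + q (exp g - 1)\<close>, at most
  \<open>exp (q (exp g - 1))\<close>. The 2 inside the exponential and the outer halving are the
  price of allowing an asymmetric \<open>f\<close>, as arises from two different vectors or vertex
  sets.\<close>

lemma expectation_exp_le:
  fixes f :: "nat \<Rightarrow> nat \<Rightarrow> real"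
  assumes p: "edge_probs n p"
  shows "measure_pmf.expectation (inhom_ER n p)
      (\<lambda>A. exp (\<Sum>i\<in>{1..n}. \<Sum>j\<in>{1..n}. f i j * A i j))
    \<le> exp ((\<Sum>i\<in>{1..n}. \<Sum>j\<in>{1..n}. p i j * (exp (2 * f i j) - 1)) / 2)"
proof -
  define g where "g e = (if fst e = snd e then f (fst e) (snd e)
       else f (fst e) (snd e) + f (snd e) (fst e))" for e
  define q where "q e = p (fst e) (snd e)" for e
  let ?P = "Pi_pmf (edge_slots n) False (\<lambda>(i, j). bernoulli_pmf (p i j))"
  have q: "0 \<le> q e" "q e \<le> 1" if "e \<in> edge_slots n" for e
    using p that by (auto simp: edge_probs_def edge_slots_def q_def)
  have *: "(\<Sum>i\<in>{1..n}. \<Sum>j\<in>{1..n}. f i j * adj_matrix n E i j) =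
      (\<Sum>e\<in>edge_slots n. g e * of_bool (E e))" for E
    unfolding sum_grid_eq_sum_slots
    by (rule sum.cong)
       (auto simp: edge_slots_def adj_matrix_def g_def min_def max_def algebra_simps)
  have "measure_pmf.expectation (inhom_ER n p)
      (\<lambda>A. exp (\<Sum>i\<in>{1..n}. \<Sum>j\<in>{1..n}. f i j * A i j)) =
    measure_pmf.expectation ?P (\<lambda>E. \<Prod>e\<in>edge_slots n. exp (g e * of_bool (E e)))"
    by (simp only: inhom_ER_def integral_map_pmf * exp_sum[OF finite_edge_slots])
  also have "\<dots> = (\<Prod>e\<in>edge_slots n. measure_pmf.expectation
      ((\<lambda>(i, j). bernoulli_pmf (p i j)) e) (\<lambda>b. exp (g e * of_bool b)))"
    by (rule expectation_prod_Pi_pmf) (auto intro: integrable_measure_pmf_finite)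
  also have "\<dots> = (\<Prod>e\<in>edge_slots n. 1 + q e * (exp (g e) - 1))"
    using q by (intro prod.cong) (auto simp: q_def case_prod_unfold algebra_simps)
  also have "\<dots> \<le> (\<Prod>e\<in>edge_slots n. exp (q e * (exp (g e) - 1)))"
  proof (intro prod_mono conjI)
    fix e assume "e \<in> edge_slots n"
    then have "0 \<le> q e * exp (g e) + (1 - q e)"
      using q by (intro add_nonneg_nonneg mult_nonneg_nonneg) auto
    then show "0 \<le> 1 + q e * (exp (g e) - 1)" by (simp add: algebra_simps)
  qed (rule exp_ge_add_one_self)
  also have "\<dots> = exp (\<Sum>e\<in>edge_slots n. q e * (exp (g e) - 1))"
    by (simp add: exp_sum)
  also have "\<dots> \<le> exp ((\<Sum>i\<in>{1..n}. \<Sum>j\<in>{1..n}. p i j * (exp (2 * f i j) - 1)) / 2)"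
  proof -
    text \<open>Each off-diagonal slot is split into its two ordered copies by
      \<open>exp (x + y) \<le> (exp (2 * x) + exp (2 * y)) / 2\<close>, which decouples the symmetric entries.\<close>
    have sq: "exp (2 * x) = (exp x)\<^sup>2" for x :: real
      by (simp add: exp_double)
    have key1: "exp x - 1 \<le> (exp (2 * x) - 1) / 2" for x :: real
      using zero_le_power2[of "exp x - 1"] unfolding sq by (simp add: power2_eq_square algebra_simps)
    have key2: "exp (x + y) - 1 \<le> (exp (2 * x) - 1) / 2 + (exp (2 * y) - 1) / 2" for x y :: real
      using zero_le_power2[of "exp x - exp y"] unfolding sq
      by (simp add: exp_add power2_eq_square field_simps)
    have "(\<Sum>e\<in>edge_slots n. q e * (exp (g e) - 1)) \<le>
      (\<Sum>e\<in>edge_slots n. if fst e = snd e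
        then p (fst e) (snd e) * ((exp (2 * f (fst e) (snd e)) - 1) / 2)
        else p (fst e) (snd e) * ((exp (2 * f (fst e) (snd e)) - 1) / 2) +
          p (snd e) (fst e) * ((exp (2 * f (snd e) (fst e)) - 1) / 2))"
    proof (rule sum_mono)
      fix e assume e: "e \<in> edge_slots n"
      have sym: "p (snd e) (fst e) = p (fst e) (snd e)"
        using p e by (auto simp: edge_probs_def edge_slots_def)
      show "q e * (exp (g e) - 1) \<le> (if fst e = snd e
        then p (fst e) (snd e) * ((exp (2 * f (fst e) (snd e)) - 1) / 2)
        else p (fst e) (snd e) * ((exp (2 * f (fst e) (snd e)) - 1) / 2) +
          p (snd e) (fst e) * ((exp (2 * f (snd e) (fst e)) - 1) / 2))"
        using mult_left_mono[OF key1[of "f (fst e) (snd e)"] q(1)[OF e]]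
          mult_left_mono[OF key2[of "f (fst e) (snd e)" "f (snd e) (fst e)"] q(1)[OF e]]
        by (auto simp: g_def q_def sym ring_distribs)
    qed
    also have "\<dots> = (\<Sum>i\<in>{1..n}. \<Sum>j\<in>{1..n}. p i j * ((exp (2 * f i j) - 1) / 2))"
      by (rule sum_grid_eq_sum_slots[symmetric])
    also have "\<dots> = (\<Sum>i\<in>{1..n}. \<Sum>j\<in>{1..n}. p i j * (exp (2 * f i j) - 1)) / 2"
      by (simp add: sum_divide_distrib)
    finally show ?thesis by simp
  qed
  finally show ?thesis .
qed

text \<open>Markov's inequality with exponential parameter 1; any other parameter is absorbed into
  \<open>f\<close> and \<open>m\<close>.\<close>

lemma prob_weighted_sum_ge:
  fixes f :: "nat \<Rightarrow> nat \<Rightarrow> real"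
  assumes "edge_probs n p"
  shows "measure_pmf.prob (inhom_ER n p) {A. m \<le> (\<Sum>i\<in>{1..n}. \<Sum>j\<in>{1..n}. f i j * A i j)}
    \<le> exp ((\<Sum>i\<in>{1..n}. \<Sum>j\<in>{1..n}. p i j * (exp (2 * f i j) - 1)) / 2 - m)"
proof -
  let ?G = "inhom_ER n p" and ?X = "\<lambda>A. \<Sum>i\<in>{1..n}. \<Sum>j\<in>{1..n}. f i j * (A i j :: real)"
  have "measure_pmf.prob ?G {A. m \<le> ?X A} =
      measure_pmf.expectation ?G (indicator {A. m \<le> ?X A})"
    by simp
  also have "\<dots> \<le> measure_pmf.expectation ?G (\<lambda>A. exp (- m) * exp (?X A))"
    by (intro integral_mono) (auto simp: indicator_def simp flip: exp_add)
  also have "\<dots> = exp (- m) * measure_pmf.expectation ?G (\<lambda>A. exp (?X A))"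
    by simp
  also have "\<dots> \<le> exp (- m) * exp ((\<Sum>i\<in>{1..n}. \<Sum>j\<in>{1..n}. p i j * (exp (2 * f i j) - 1)) / 2)"
    by (intro mult_left_mono expectation_exp_le assms) auto
  also have "\<dots> = exp ((\<Sum>i\<in>{1..n}. \<Sum>j\<in>{1..n}. p i j * (exp (2 * f i j) - 1)) / 2 - m)"
    by (simp flip: exp_add)
  finally show ?thesis .
qed

text \<open>Bernstein type: the bound on \<open>f\<close> admits the quadratic estimate of
  \<open>exp (2 * f i j)\<close>, whose linear part cancels the centring and whose quadratic part
  leaves the variance.\<close>

lemma prob_centered_sum_ge:
  fixes f :: "nat \<Rightarrow> nat \<Rightarrow> real"
  assumes p: "edge_probs n p"
    and f: "\<And>i j. i \<in> {1..n} \<Longrightarrow> j \<in> {1..n} \<Longrightarrow> \<bar>f i j\<bar> \<le> 1 / 2"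
  shows "measure_pmf.prob (inhom_ER n p)
      {A. m \<le> (\<Sum>i\<in>{1..n}. \<Sum>j\<in>{1..n}. f i j * (A i j - p i j))}
    \<le> exp (2 * (\<Sum>i\<in>{1..n}. \<Sum>j\<in>{1..n}. p i j * (f i j)\<^sup>2) - m)"
proof -
  let ?c = "\<Sum>i\<in>{1..n}. \<Sum>j\<in>{1..n}. f i j * p i j"
  have "{A. m \<le> (\<Sum>i\<in>{1..n}. \<Sum>j\<in>{1..n}. f i j * (A i j - p i j))} =
      {A. m + ?c \<le> (\<Sum>i\<in>{1..n}. \<Sum>j\<in>{1..n}. f i j * A i j)}"
    by (auto simp: right_diff_distrib sum_subtractf)
  moreover have "measure_pmf.prob (inhom_ER n p) \<dots> \<le>
      exp ((\<Sum>i\<in>{1..n}. \<Sum>j\<in>{1..n}. p i j * (exp (2 * f i j) - 1)) / 2 - (m + ?c))"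
    by (rule prob_weighted_sum_ge[OF p])
  moreover have "(\<Sum>i\<in>{1..n}. \<Sum>j\<in>{1..n}. p i j * (exp (2 * f i j) - 1)) \<le>
      (\<Sum>i\<in>{1..n}. \<Sum>j\<in>{1..n}. 2 * (f i j * p i j) + 4 * (p i j * (f i j)\<^sup>2))"
  proof (intro sum_mono)
    fix i j assume ij: "i \<in> {1..n}" "j \<in> {1..n}"
    have "exp (2 * f i j) - 1 \<le> 2 * f i j + 4 * (f i j)\<^sup>2"
      using exp_le_quadratic[of "2 * f i j"] f[OF ij] by (simp add: power_mult_distrib abs_mult)
    moreover have "0 \<le> p i j" using p ij by (auto simp: edge_probs_def)
    ultimately have "p i j * (exp (2 * f i j) - 1) \<le> p i j * (2 * f i j + 4 * (f i j)\<^sup>2)"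
      by (intro mult_left_mono)
    then show "p i j * (exp (2 * f i j) - 1) \<le> 2 * (f i j * p i j) + 4 * (p i j * (f i j)\<^sup>2)"
      by (simp add: algebra_simps)
  qed
  moreover have "\<dots> = 2 * ?c + 4 * (\<Sum>i\<in>{1..n}. \<Sum>j\<in>{1..n}. p i j * (f i j)\<^sup>2)"
    by (simp add: sum.distrib sum_distrib_left)
  ultimately show ?thesis
    by (auto elim!: order_trans simp del: sum.cl_ivl_Suc)
qed

text \<open>Ordered pairs are counted: an edge joining two distinct vertices common to
  \<open>S\<close> and \<open>T\<close> contributes twice, a loop once.\<close>

definition edge_count :: "(nat \<Rightarrow> nat \<Rightarrow> real) \<Rightarrow> nat set \<Rightarrow> nat set \<Rightarrow> real" where
  "edge_count A S T = (\<Sum>i\<in>S. \<Sum>j\<in>T. A i j)"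

text \<open>The parameter \<open>l\<close> stays free because two choices are made later:
  \<open>ln (m / \<mu>) / 2\<close> for the discrepancy and \<open>1 / 2\<close> for degree
  sums.\<close>

lemma prob_edge_count_ge:
  assumes p: "edge_probs n p" and ST: "S \<subseteq> {1..n}" "T \<subseteq> {1..n}" and l: "0 \<le> l"
    and q: "\<And>i j. i \<in> {1..n} \<Longrightarrow> j \<in> {1..n} \<Longrightarrow> p i j \<le> q"
  shows "measure_pmf.prob (inhom_ER n p) {A. m \<le> edge_count A S T}
    \<le> exp ((exp (2 * l) - 1) / 2 * (q * card S * card T) - l * m)"
proof -
  let ?f = "\<lambda>i j. if i \<in> S \<and> j \<in> T then l else 0"
  have restrict: "(\<Sum>i\<in>{1..n}. \<Sum>j\<in>{1..n}. if i \<in> S \<and> j \<in> T then h i j else 0) =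
      (\<Sum>i\<in>S. \<Sum>j\<in>T. h i j)" for h :: "nat \<Rightarrow> nat \<Rightarrow> real"
  proof -
    have "(\<Sum>j\<in>{1..n}. if i \<in> S \<and> j \<in> T then h i j else 0) =
        (if i \<in> S then \<Sum>j\<in>T. h i j else 0)" for i
      using ST by (auto simp: Int_absorb1 simp flip: sum.inter_restrict)
    then show ?thesis
      using ST by (auto simp: Int_absorb1 simp flip: sum.inter_restrict)
  qed
  have "(\<Sum>i\<in>{1..n}. \<Sum>j\<in>{1..n}. ?f i j * A i j) = l * edge_count A S T" for A
    unfolding edge_count_def sum_distrib_left restrict[symmetric]
    by (intro sum.cong) auto
  then have "{A. m \<le> edge_count A S T} \<subseteq> {A. l * m \<le> (\<Sum>i\<in>{1..n}. \<Sum>j\<in>{1..n}. ?f i j * A i j)}"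
    using l by (auto intro: mult_left_mono)
  then have "measure_pmf.prob (inhom_ER n p) {A. m \<le> edge_count A S T} \<le>
      measure_pmf.prob (inhom_ER n p) {A. l * m \<le> (\<Sum>i\<in>{1..n}. \<Sum>j\<in>{1..n}. ?f i j * A i j)}"
    by (intro measure_pmf.finite_measure_mono) auto
  also have "\<dots> \<le> exp ((\<Sum>i\<in>{1..n}. \<Sum>j\<in>{1..n}. p i j * (exp (2 * ?f i j) - 1)) / 2 - l * m)"
    by (rule prob_weighted_sum_ge[OF p])
  also have "(\<Sum>i\<in>{1..n}. \<Sum>j\<in>{1..n}. p i j * (exp (2 * ?f i j) - 1)) =
      (\<Sum>i\<in>S. \<Sum>j\<in>T. p i j * (exp (2 * l) - 1))"
    unfolding restrict[symmetric] by (intro sum.cong) auto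
  also have "\<dots> \<le> (\<Sum>i\<in>S. \<Sum>j\<in>T. q * (exp (2 * l) - 1))"
    using ST l by (intro sum_mono mult_right_mono q) auto
  also have "\<dots> = (exp (2 * l) - 1) * (q * card S * card T)"
    by simp
  finally show ?thesis by simp
qed

section \<open>Typical properties of the random graph\<close>

text \<open>Bounds the logarithm of the number of \<open>t\<close>-element subsets of \<open>{1..n}\<close>.\<close>

definition subset_entropy :: "nat \<Rightarrow> real \<Rightarrow> real" where
  "subset_entropy n t = t * (1 + ln (real n / t))"

text \<open>The derivative in \<open>t\<close> is \<open>ln (n / t)\<close>, nonnegative up to
  \<open>t = n\<close>; calculus is replaced by \<open>ln x <= x - 1\<close> at
  \<open>x = t / s\<close>.\<close>

lemma subset_entropy_mono:
  assumes "0 < s" "s \<le> t" "t \<le> real n"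
  shows "subset_entropy n s \<le> subset_entropy n t"
proof -
  have "ln (real n / s) = ln (real n / t) + ln (t / s)"
    using assms by (simp add: ln_div)
  also have "\<dots> \<le> ln (real n / t) + (t / s - 1)"
    using assms by (intro add_left_mono ln_le_minus_one) auto
  finally have "subset_entropy n s \<le> s * (1 + (ln (real n / t) + (t / s - 1)))"
    unfolding subset_entropy_def using assms by (intro mult_left_mono) auto
  also have "\<dots> = s * ln (real n / t) + t"
    using assms by (simp add: algebra_simps)
  also have "\<dots> \<le> t * ln (real n / t) + t"
    using assms by (intro add_right_mono mult_right_mono) auto
  also have "\<dots> = subset_entropy n t"
    by (simp add: subset_entropy_def algebra_simps)
  finally show ?thesis .
qed

text \<open>Single vertices are the bottleneck of the union bounds over sets: a multiple of
  \<open>r\<close> times this minimum produces \<open>n powr (- r)\<close>.\<close>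

lemma subset_entropy_ge:
  assumes "1 \<le> t" "t \<le> real n"
  shows "1 + ln (real n) \<le> subset_entropy n t"
  using subset_entropy_mono[of 1 t n] assms by (simp add: subset_entropy_def)

lemma binomial_le_exp_subset_entropy:
  assumes "1 \<le> s" "s \<le> n"
  shows "real (n choose s) \<le> exp (subset_entropy n s)"
proof -
  \<comment> \<open>A single term of the expansion of \<open>(1 + x) ^ n\<close> at
    \<open>x = s / n\<close> gives the classical bound \<open>(e n / s) ^ s\<close>.\<close>
  define x where "x = real s / real n"
  have x: "0 < x" using assms by (simp add: x_def)
  have "real (n choose s) * x ^ s = real (n choose s) * x ^ s * 1 ^ (n - s)" by simp
  also have "\<dots> \<le> (\<Sum>k\<le>n. real (n choose k) * x ^ k * 1 ^ (n - k))"
    using assms x by (intro member_le_sum) auto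
  also have "\<dots> = (x + 1) ^ n"
    by (rule binomial_ring[symmetric])
  also have "\<dots> \<le> exp x ^ n"
    using x exp_ge_add_one_self[of x] by (intro power_mono) (auto simp: add.commute)
  also have "\<dots> = exp s"
    using assms by (simp add: x_def flip: exp_of_nat_mult)
  finally have *: "real (n choose s) * x ^ s \<le> exp s" .
  have "exp (subset_entropy n s) = exp s * exp (real s * ln (1 / x))"
    by (simp add: subset_entropy_def x_def ring_distribs exp_add)
  also have "exp (real s * ln (1 / x)) = (1 / x) ^ s"
    using x by (simp add: exp_of_nat_mult)
  finally show ?thesis
    using * x by (simp add: power_divide pos_le_divide_eq)
qed

lemma card_nonempty_subset:
  assumes "S \<in> Pow {1..n} - {{}}"
  shows "1 \<le> card S" "card S \<le> n"
  using assms card_mono[of "{1..n}" S] finite_subset[of S "{1..n}"]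
  by (auto simp: Suc_le_eq card_gt_0_iff)

text \<open>Each of the \<open>n\<close> possible sizes contributes at most 1, since the weight
  cancels the number of sets of that size.\<close>

lemma sum_exp_subset_entropy_le:
  "(\<Sum>S\<in>Pow {1..n} - {{}}. exp (- subset_entropy n (card S))) \<le> real n"
proof -
  let ?P = "Pow {1..n} - {{}}"
  have img: "card ` ?P \<subseteq> {1..n}"
    using card_nonempty_subset by (intro image_subsetI) (simp only: atLeastAtMost_iff)
  have "(\<Sum>S\<in>?P. exp (- subset_entropy n (card S))) =
      (\<Sum>s\<in>{1..n}. \<Sum>S\<in>{S\<in>?P. card S = s}. exp (- subset_entropy n (card S)))"
    by (intro sum.group[symmetric] img) auto
  also have "\<dots> = (\<Sum>s\<in>{1..n}. card {S\<in>?P. card S = s} * exp (- subset_entropy n s))"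
    by simp
  also have "\<dots> \<le> (\<Sum>s\<in>{1..n}. 1)"
  proof (rule sum_mono)
    fix s assume s: "s \<in> {1..n}"
    have "{S\<in>?P. card S = s} = {S. S \<subseteq> {1..n} \<and> card S = s}" using s by auto
    then have "card {S\<in>?P. card S = s} = n choose s"
      by (simp add: n_subsets)
    then have "real (card {S\<in>?P. card S = s}) \<le> exp (subset_entropy n s)"
      using binomial_le_exp_subset_entropy[of s n] s by auto
    then show "card {S\<in>?P. card S = s} * exp (- subset_entropy n s) \<le> 1"
      by (simp add: exp_minus divide_simps)
  qed
  finally show ?thesis by simp
qed

text \<open>Tail bounds concern thresholds, but the discrepancy event asks for membership in a set
  of values. On the finite support the smallest attained value in \<open>M\<close> serves as
  threshold, which avoids any monotonicity of \<open>m ln (m / \<mu>)\<close>.\<close>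

lemma prob_in_le:
  fixes X :: "'a \<Rightarrow> real"
  assumes "finite (set_pmf G)" "0 \<le> c" "\<And>m. m \<in> M \<Longrightarrow> measure_pmf.prob G {x. m \<le> X x} \<le> c"
  shows "measure_pmf.prob G {x. X x \<in> M} \<le> c"
proof (cases "{x. X x \<in> M} \<inter> set_pmf G = {}")
  case True
  then show ?thesis
    using assms(2) measure_pmf_zero_iff[of G "{x. X x \<in> M}"] by (simp add: Int_commute)
next
  case False
  let ?B = "X ` ({x. X x \<in> M} \<inter> set_pmf G)"
  have fin: "finite ?B" "?B \<noteq> {}" using False assms(1) by auto
  have "measure_pmf.prob G {x. X x \<in> M} = measure_pmf.prob G ({x. X x \<in> M} \<inter> set_pmf G)"
    by (simp add: measure_Int_set_pmf)
  also have "\<dots> \<le> measure_pmf.prob G {x. Min ?B \<le> X x}"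
    using fin by (intro measure_pmf.finite_measure_mono) auto
  also have "\<dots> \<le> c"
    using Min_in[OF fin] by (intro assms(3)) auto
  finally show ?thesis .
qed

lemma prob_Bex_le:
  assumes "finite I"
  shows "measure_pmf.prob G {x. \<exists>i\<in>I. P i x} \<le> (\<Sum>i\<in>I. measure_pmf.prob G {x. P i x})"
proof -
  have "{x. \<exists>i\<in>I. P i x} = (\<Union>i\<in>I. {x. P i x})" by auto
  then show ?thesis
    using measure_UNION_le[of I "\<lambda>i. {x. P i x}" "measure_pmf G"] assms by simp
qed

text \<open>\<open>n^2\<close> pays for the sizes of two sets, the exponent \<open>8 r\<close> beats
  it with \<open>n powr (- r)\<close> left over, and a spare \<open>exp (- 3)\<close> yields the
  quarter that allows several bad events to be added.\<close>

lemma union_bound_le_powr: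
  assumes "1 \<le> n" "1 \<le> r"
  shows "(real n)\<^sup>2 * exp (- 8 * r * (1 + ln (real n))) \<le> real n powr (- r) / 4"
proof -
  have n: "0 \<le> ln (real n)" using assms by simp
  have *: "(2 - 7 * r) * ln (real n) \<le> 0"
    using assms n by (intro mult_nonpos_nonneg) auto
  have "(real n)\<^sup>2 = exp (2 * ln (real n))"
    using assms by (simp add: exp_double)
  then have "(real n)\<^sup>2 * exp (- 8 * r * (1 + ln (real n))) =
      exp (- r * ln (real n)) * exp (- 8 * r + (2 - 7 * r) * ln (real n))"
    by (simp add: algebra_simps flip: exp_add)
  also have "\<dots> \<le> exp (- r * ln (real n)) * exp (- 3)"
    using assms * by (intro mult_left_mono iffD2[OF exp_le_cancel_iff]) auto
  also have "\<dots> \<le> exp (- r * ln (real n)) * (1 / 4)"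
    using exp_ge_add_one_self[of 3] by (intro mult_left_mono) (auto simp: exp_minus divide_simps)
  also have "\<dots> = real n powr (- r) / 4"
    using assms by (simp add: powr_def)
  finally show ?thesis .
qed

text \<open>The alternative of Kahn and Szemeredi: the count is comparable to the mean bound
  \<open>\<mu>\<close>, or its excess is paid for by the entropy of the larger set. The 9 exceeds
  \<open>exp 2\<close>, so \<open>ln (e / \<mu>) >= 2\<close> whenever the first alternative
  fails.\<close>

definition discrepancy_bound :: "nat \<Rightarrow> real \<Rightarrow> real \<Rightarrow> (nat \<Rightarrow> nat \<Rightarrow> real) \<Rightarrow> bool" where
  "discrepancy_bound n d r A \<longleftrightarrow>
    (\<forall>S T. S \<subseteq> {1..n} \<longrightarrow> T \<subseteq> {1..n} \<longrightarrow> S \<noteq> {} \<longrightarrow> card S \<le> card T \<longrightarrow>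
      (let e = edge_count A S T; \<mu> = d * card S * card T / n in
       e \<le> 9 * \<mu> \<or> e * ln (e / \<mu>) \<le> 40 * r * subset_entropy n (card T)))"

definition degree_sum_bound :: "nat \<Rightarrow> real \<Rightarrow> real \<Rightarrow> (nat \<Rightarrow> nat \<Rightarrow> real) \<Rightarrow> bool" where
  "degree_sum_bound n d r A \<longleftrightarrow>
    (\<forall>S. S \<subseteq> {1..n} \<longrightarrow> S \<noteq> {} \<longrightarrow>
      edge_count A S {1..n} \<le> 20 * r * (d * card S + subset_entropy n (card S)))"

lemma exp_2_le_9: "exp (2::real) \<le> 9"
proof -
  have "exp (2::real) = exp 1 * exp 1" by (simp flip: exp_add)
  also have "\<dots> \<le> 3 * 3" by (intro mult_mono exp_le) auto
  finally show ?thesis by simp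
qed

text \<open>Chernoff with \<open>exp (2 l) = m / \<mu>\<close>. The exponent is
  \<open>(m - \<mu>) / 2 - m ln (m / \<mu>) / 2\<close>, and as the logarithm is at least 2, half of
  the second term absorbs the first.\<close>

lemma prob_discrepancy_pair:
  fixes d \<mu> X :: real
  assumes p: "edge_probs n p" and n: "1 \<le> n" and d: "0 < d"
    and q: "\<And>i j. i \<in> {1..n} \<Longrightarrow> j \<in> {1..n} \<Longrightarrow> p i j \<le> d / n"
    and ST: "S \<subseteq> {1..n}" "T \<subseteq> {1..n}" "S \<noteq> {}" "T \<noteq> {}"
    and \<mu>: "\<mu> = d * card S * card T / n"
  shows "measure_pmf.prob (inhom_ER n p)
     {A. \<not> (edge_count A S T \<le> 9 * \<mu> \<or> edge_count A S T * ln (edge_count A S T / \<mu>) \<le> X)}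
    \<le> exp (- X / 4)"
proof -
  have fin: "finite S" "finite T" using ST finite_subset by blast+
  have \<mu>_pos: "0 < \<mu>" using fin ST d n by (auto simp: \<mu> card_gt_0_iff)
  have "measure_pmf.prob (inhom_ER n p) {A. edge_count A S T \<in> {m. 9 * \<mu> < m \<and> X < m * ln (m / \<mu>)}}
      \<le> exp (- X / 4)"
  proof (rule prob_in_le[OF finite_set_inhom_ER])
    fix m assume "m \<in> {m. 9 * \<mu> < m \<and> X < m * ln (m / \<mu>)}"
    then have m: "9 * \<mu> < m" "X < m * ln (m / \<mu>)" by auto
    have m_pos: "0 < m" using m \<mu>_pos by linarith
    have "9 \<le> m / \<mu>" using m \<mu>_pos by (simp add: pos_le_divide_eq)
    then have "exp 2 \<le> m / \<mu>" using exp_2_le_9 by linarith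
    then have l: "2 \<le> ln (m / \<mu>)" using m_pos \<mu>_pos by (simp add: ln_ge_iff)
    have "measure_pmf.prob (inhom_ER n p) {A. m \<le> edge_count A S T} \<le>
        exp ((exp (2 * (ln (m / \<mu>) / 2)) - 1) / 2 * (d / n * card S * card T) - ln (m / \<mu>) / 2 * m)"
      using l by (intro prob_edge_count_ge p ST q) auto
    also have "\<dots> = exp ((m / \<mu> - 1) / 2 * \<mu> - ln (m / \<mu>) / 2 * m)"
    proof -
      have "exp (2 * (ln (m / \<mu>) / 2)) = m / \<mu>" using m_pos \<mu>_pos by simp
      moreover have "d / n * card S * card T = \<mu>" by (simp add: \<mu>)
      ultimately show ?thesis by (simp only:)
    qed
    also have "\<dots> \<le> exp (- X / 4)"
    proof -
      have "(m / \<mu> - 1) / 2 * \<mu> - ln (m / \<mu>) / 2 * m = (m - \<mu>) / 2 - (m * ln (m / \<mu>)) / 2"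
        using \<mu>_pos by (simp add: field_simps)
      also have "\<dots> \<le> - X / 4"
      proof -
        define Z where "Z = m * ln (m / \<mu>)"
        have "m * 2 \<le> Z" unfolding Z_def using l m_pos by (intro mult_left_mono) auto
        moreover have "X < Z" using m(2) by (simp only: Z_def)
        ultimately have "(m - \<mu>) / 2 - Z / 2 \<le> - X / 4" using \<mu>_pos by (simp add: field_simps)
        then show ?thesis by (simp only: Z_def)
      qed
      finally show ?thesis by simp
    qed
    finally show "measure_pmf.prob (inhom_ER n p) {A. m \<le> edge_count A S T} \<le> exp (- X / 4)" .
  qed auto
  then show ?thesis by (simp add: not_le)
qed

lemma prob_not_discrepancy_bound:
  fixes d r :: real
  assumes p: "edge_probs n p" and n: "1 \<le> n" and d: "0 < d" and r: "1 \<le> r"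
    and q: "\<And>i j. i \<in> {1..n} \<Longrightarrow> j \<in> {1..n} \<Longrightarrow> p i j \<le> d / n"
  shows "measure_pmf.prob (inhom_ER n p) {A. \<not> discrepancy_bound n d r A} \<le> real n powr (- r) / 4"
proof -
  let ?P = "Pow {1..n} - {{}}" and ?h = "\<lambda>S. subset_entropy n (card (S :: nat set))"
  let ?I = "{(S, T)\<in>?P \<times> ?P. card S \<le> card T}"
  let ?bad = "\<lambda>(S, T) A. \<not> (edge_count A S T \<le> 9 * (d * card S * card T / n) \<or>
    edge_count A S T * ln (edge_count A S T / (d * card S * card T / n)) \<le> 40 * r * ?h T)"
  have card: "1 \<le> real (card S)" "real (card S) \<le> real n" if "S \<in> ?P" for S
    using card_nonempty_subset[OF that] by auto
  have fin: "finite ?I" by (rule finite_subset[of _ "?P \<times> ?P"]) auto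
  have "{A. \<not> discrepancy_bound n d r A} \<subseteq> {A. \<exists>i\<in>?I. ?bad i A}"
  proof
    fix A assume "A \<in> {A. \<not> discrepancy_bound n d r A}"
    then obtain S T where ST: "S \<subseteq> {1..n}" "T \<subseteq> {1..n}" "S \<noteq> {}" "card S \<le> card T"
      and bad: "?bad (S, T) A"
      unfolding discrepancy_bound_def Let_def mem_Collect_eq not_all not_imp prod.case by blast
    have "(S, T) \<in> ?I"
      using ST finite_subset[of S "{1..n}"] by (auto simp: card_eq_0_iff)
    then show "A \<in> {A. \<exists>i\<in>?I. ?bad i A}"
      using bad by - (rule CollectI, rule bexI[of _ "(S, T)"])
  qed
  then have "measure_pmf.prob (inhom_ER n p) {A. \<not> discrepancy_bound n d r A} \<le>
      measure_pmf.prob (inhom_ER n p) {A. \<exists>i\<in>?I. ?bad i A}"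
    by (intro measure_pmf.finite_measure_mono) auto
  also have "\<dots> \<le> (\<Sum>i\<in>?I. measure_pmf.prob (inhom_ER n p) {A. ?bad i A})"
    by (rule prob_Bex_le[OF fin])
  also have "\<dots> \<le> (\<Sum>(S, T)\<in>?I. exp (- 8 * r * (1 + ln (real n))) * (exp (- ?h S) * exp (- ?h T)))"
  proof (rule sum_mono)
    fix i assume i: "i \<in> ?I"
    obtain S T where [simp]: "i = (S, T)" by (cases i)
    have S: "S \<in> ?P" and T: "T \<in> ?P" and c: "card S \<le> card T" using i by auto
    have "?h S \<le> ?h T" using card[OF S] card[OF T] c by (intro subset_entropy_mono) auto
    moreover have hT: "1 + ln (real n) \<le> ?h T"
      using card[OF T] by (intro subset_entropy_ge) auto
    moreover have "1 * ?h T \<le> r * ?h T"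
      using r hT n by (intro mult_right_mono order_trans[OF _ hT]) auto
    moreover have "r * (1 + ln (real n)) \<le> r * ?h T"
      using r hT by (intro mult_left_mono) auto
    \<comment> \<open>Of the \<open>10 r\<close> copies of \<open>?h T\<close>, \<open>8 r\<close>
      pay for \<open>1 + ln n\<close> and the others for the two entropies.\<close>
    ultimately have *: "- (40 * r * ?h T) / 4 \<le> - 8 * r * (1 + ln (real n)) + (- ?h S - ?h T)"
      by (simp add: algebra_simps)
    have "measure_pmf.prob (inhom_ER n p) {A. ?bad i A} \<le> exp (- (40 * r * ?h T) / 4)"
      using S T prob_discrepancy_pair[OF p n d q, of S T "d * card S * card T / n" "40 * r * ?h T"]
      by simp
    also have "\<dots> \<le> exp (- 8 * r * (1 + ln (real n)) + (- ?h S - ?h T))"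
      using * by simp
    also have "\<dots> = exp (- 8 * r * (1 + ln (real n))) * (exp (- ?h S) * exp (- ?h T))"
      by (simp flip: exp_add)
    finally show "measure_pmf.prob (inhom_ER n p) {A. ?bad i A} \<le>
      (case i of (S, T) \<Rightarrow> exp (- 8 * r * (1 + ln (real n))) * (exp (- ?h S) * exp (- ?h T)))"
      by simp
  qed
  also have "\<dots> \<le> (\<Sum>(S, T)\<in>?P \<times> ?P. exp (- 8 * r * (1 + ln (real n))) * (exp (- ?h S) * exp (- ?h T)))"
    by (intro sum_mono2) auto
  also have "\<dots> = exp (- 8 * r * (1 + ln (real n))) * ((\<Sum>S\<in>?P. exp (- ?h S)) * (\<Sum>T\<in>?P. exp (- ?h T)))"
    by (subst sum_product, subst sum.cartesian_product) (simp add: sum_distrib_left case_prod_unfold)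
  also have "\<dots> \<le> exp (- 8 * r * (1 + ln (real n))) * (real n * real n)"
    by (intro mult_left_mono mult_mono sum_exp_subset_entropy_le sum_nonneg) auto
  also have "\<dots> = (real n)\<^sup>2 * exp (- 8 * r * (1 + ln (real n)))"
    by (simp add: power2_eq_square)
  also have "\<dots> \<le> real n powr (- r) / 4"
    by (rule union_bound_le_powr[OF n r])
  finally show ?thesis .
qed

lemma prob_not_degree_sum_bound:
  fixes d r :: real
  assumes p: "edge_probs n p" and n: "1 \<le> n" and d: "0 \<le> d" and r: "1 \<le> r"
    and q: "\<And>i j. i \<in> {1..n} \<Longrightarrow> j \<in> {1..n} \<Longrightarrow> p i j \<le> d / n"
  shows "measure_pmf.prob (inhom_ER n p) {A. \<not> degree_sum_bound n d r A} \<le> real n powr (- r) / 4"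
proof -
  let ?P = "Pow {1..n} - {{}}" and ?h = "\<lambda>S. subset_entropy n (card (S :: nat set))"
  let ?m = "\<lambda>S. 20 * r * (d * card S + ?h S)"
  have card: "1 \<le> real (card S)" "real (card S) \<le> real n" if "S \<in> ?P" for S
    using card_nonempty_subset[OF that] by auto
  have "{A. \<not> degree_sum_bound n d r A} \<subseteq> {A. \<exists>S\<in>?P. ?m S \<le> edge_count A S {1..n}}"
  proof
    fix A assume "A \<in> {A. \<not> degree_sum_bound n d r A}"
    then obtain S where "S \<in> ?P" "?m S < edge_count A S {1..n}"
      unfolding degree_sum_bound_def mem_Collect_eq not_all not_imp not_le by blast
    then show "A \<in> {A. \<exists>S\<in>?P. ?m S \<le> edge_count A S {1..n}}"
      by (intro CollectI bexI[of _ S]) simp_all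
  qed
  then have "measure_pmf.prob (inhom_ER n p) {A. \<not> degree_sum_bound n d r A} \<le>
      measure_pmf.prob (inhom_ER n p) {A. \<exists>S\<in>?P. ?m S \<le> edge_count A S {1..n}}"
    by (intro measure_pmf.finite_measure_mono) auto
  also have "\<dots> \<le> (\<Sum>S\<in>?P. measure_pmf.prob (inhom_ER n p) {A. ?m S \<le> edge_count A S {1..n}})"
    by (rule prob_Bex_le) auto
  also have "\<dots> \<le> (\<Sum>S\<in>?P. exp (- 8 * r * (1 + ln (real n))) * exp (- ?h S))"
  proof (rule sum_mono)
    fix S assume S: "S \<in> ?P"
    have hS: "1 + ln (real n) \<le> ?h S"
      using card[OF S] by (intro subset_entropy_ge) auto
    have "1 * ?h S \<le> r * ?h S"
      using r hS n by (intro mult_right_mono order_trans[OF _ hS]) auto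
    moreover have "r * (1 + ln (real n)) \<le> r * ?h S"
      using r hS by (intro mult_left_mono) auto
    moreover have "1 * (d * card S) \<le> r * (d * card S)"
      using r d by (intro mult_right_mono) auto
    moreover have "0 \<le> d * card S" "0 \<le> ?h S" using d n order_trans[OF _ hS] by auto
    ultimately have *: "d * card S - 1 / 2 * ?m S \<le> - 8 * r * (1 + ln (real n)) - ?h S"
      by (simp add: algebra_simps)
    \<comment> \<open>Chernoff with \<open>l = 1 / 2\<close>. As \<open>(exp 1 - 1) / 2\<close> is
      at most 1, one copy of the mean stands against the \<open>10 r\<close> copies in the
      threshold.\<close>
    have "measure_pmf.prob (inhom_ER n p) {A. ?m S \<le> edge_count A S {1..n}} \<le>
        exp ((exp (2 * (1 / 2)) - 1) / 2 * (d / n * card S * card {1..n}) - 1 / 2 * ?m S)"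
      using S by (intro prob_edge_count_ge p q) auto
    also have "\<dots> = exp ((exp 1 - 1) / 2 * (d * card S) - 1 / 2 * ?m S)"
      using n by simp
    also have "\<dots> \<le> exp (1 * (d * card S) - 1 / 2 * ?m S)"
      using d exp_le by (intro iffD2[OF exp_le_cancel_iff] diff_right_mono mult_right_mono) auto
    also have "\<dots> \<le> exp (- 8 * r * (1 + ln (real n)) - ?h S)"
      using * by simp
    finally show "measure_pmf.prob (inhom_ER n p) {A. ?m S \<le> edge_count A S {1..n}} \<le>
        exp (- 8 * r * (1 + ln (real n))) * exp (- ?h S)"
      by (simp add: exp_diff exp_minus divide_inverse mult_ac)
  qed
  also have "\<dots> = exp (- 8 * r * (1 + ln (real n))) * (\<Sum>S\<in>?P. exp (- ?h S))"
    by (simp add: sum_distrib_left)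
  also have "\<dots> \<le> exp (- 8 * r * (1 + ln (real n))) * (real n)\<^sup>2"
    using n by (intro mult_left_mono order_trans[OF sum_exp_subset_entropy_le])
      (auto simp: power2_eq_square)
  also have "\<dots> \<le> real n powr (- r) / 4"
    using union_bound_le_powr[OF n r] by (simp add: mult.commute)
  finally show ?thesis .
qed

text \<open>Integer points in a ball of radius \<open>2 sqrt n\<close> play the part of a net;
  rounding takes squared norm \<open>n\<close> to at most \<open>2 n + 2 n\<close>. Extensionality
  keeps the set finite.\<close>

definition lattice_ball :: "nat \<Rightarrow> (nat \<Rightarrow> int) set" where
  "lattice_ball n =
    {k \<in> {1..n} \<rightarrow>\<^sub>E UNIV. (\<Sum>i\<in>{1..n}. (real_of_int (k i))\<^sup>2) \<le> 4 * real n}"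

lemma sum_half_powers_le: "(\<Sum>m\<in>{- int N..int N}. (1 / 2 :: real) ^ nat \<bar>m\<bar>) = 3 - 2 / 2 ^ N"
proof (induction N)
  case (Suc N)
  have "{- int (Suc N)..int (Suc N)} = insert (int (Suc N)) (insert (- int (Suc N)) {- int N..int N})"
    by auto
  then have "(\<Sum>m\<in>{- int (Suc N)..int (Suc N)}. (1 / 2 :: real) ^ nat \<bar>m\<bar>) =
      (1 / 2) ^ Suc N + ((1 / 2) ^ Suc N + (3 - 2 / 2 ^ N))"
    using Suc by (simp add: nat_add_distrib)
  also have "\<dots> = 3 - 2 / 2 ^ Suc N" by (simp add: power_divide field_simps)
  finally show ?case .
qed simp

lemma abs_le_power2_int: "\<bar>m\<bar> \<le> (m :: int)\<^sup>2"
proof (cases "m = 0")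
  case False
  then have "\<bar>m\<bar> * 1 \<le> \<bar>m\<bar> * \<bar>m\<bar>" by (intro mult_left_mono) auto
  then show ?thesis by (simp add: power2_eq_square)
qed simp

text \<open>Weighting each point by \<open>exp (4 n - |k|^2) >= 1\<close> makes the sum over a box
  factorise. Each coordinate contributes at most the sum of \<open>2^(-|m|)\<close>, below 3 and
  hence below \<open>exp 2\<close>, so the total is \<open>exp (4 n + 2 n)\<close>.\<close>

lemma lattice_ball_bound:
  "finite (lattice_ball n)" "real (card (lattice_ball n)) \<le> exp (6 * real n)"
proof -
  let ?B = "{- int (4 * n)..int (4 * n)}"
  let ?F = "{1..n} \<rightarrow>\<^sub>E ?B"
  have sub: "lattice_ball n \<subseteq> ?F"
  proof
    fix k assume k: "k \<in> lattice_ball n"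
    have "k i \<in> ?B" if i: "i \<in> {1..n}" for i
    proof -
      have "(k i)\<^sup>2 \<le> (\<Sum>i\<in>{1..n}. (k i)\<^sup>2)"
        using i by (intro member_le_sum) auto
      moreover have "real_of_int (\<Sum>i\<in>{1..n}. (k i)\<^sup>2) \<le> real_of_int (4 * int n)"
        using k by (simp add: lattice_ball_def)
      ultimately have "(k i)\<^sup>2 \<le> 4 * int n" by linarith
      then have "\<bar>k i\<bar> \<le> 4 * int n" using abs_le_power2_int[of "k i"] by linarith
      then show ?thesis by (simp add: abs_le_iff)
    qed
    then show "k \<in> ?F" using k by (auto simp: lattice_ball_def PiE_iff)
  qed
  have finF: "finite ?F" by (intro finite_PiE) auto
  show "finite (lattice_ball n)" by (rule finite_subset[OF sub finF])
  have "real (card (lattice_ball n)) = (\<Sum>k\<in>lattice_ball n. 1)" by simp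
  also have "\<dots> \<le> (\<Sum>k\<in>lattice_ball n. exp (4 * real n - (\<Sum>i\<in>{1..n}. (real_of_int (k i))\<^sup>2)))"
    by (intro sum_mono) (auto simp: lattice_ball_def)
  also have "\<dots> \<le> (\<Sum>k\<in>?F. exp (4 * real n - (\<Sum>i\<in>{1..n}. (real_of_int (k i))\<^sup>2)))"
    by (intro sum_mono2 sub finF) auto
  also have "\<dots> = exp (4 * real n) * (\<Sum>k\<in>?F. \<Prod>i\<in>{1..n}. exp (- (real_of_int (k i))\<^sup>2))"
    by (simp add: sum_distrib_left sum_negf flip: exp_sum exp_add)
  also have "(\<Sum>k\<in>?F. \<Prod>i\<in>{1..n}. exp (- (real_of_int (k i))\<^sup>2)) =
      (\<Prod>i\<in>{1..n}. \<Sum>m\<in>?B. exp (- (real_of_int m)\<^sup>2))"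
    by (intro prod_sum_PiE[symmetric]) auto
  also have "\<dots> \<le> (\<Prod>i\<in>{1..n}. exp 2)"
  proof (intro prod_mono conjI sum_nonneg)
    have "(\<Sum>m\<in>?B. exp (- (real_of_int m)\<^sup>2)) \<le> (\<Sum>m\<in>?B. (1 / 2) ^ nat \<bar>m\<bar>)"
    proof (rule sum_mono)
      fix m :: int
      have "2 ^ nat \<bar>m\<bar> \<le> exp (1::real) ^ nat \<bar>m\<bar>"
        using exp_ge_add_one_self[of 1] by (intro power_mono) auto
      also have "\<dots> = exp (real (nat \<bar>m\<bar>))"
        by (simp flip: exp_of_nat_mult)
      also have "\<dots> \<le> exp ((real_of_int m)\<^sup>2)"
      proof -
        have "real_of_int \<bar>m\<bar> \<le> real_of_int (m\<^sup>2)"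
          by (simp only: of_int_le_iff abs_le_power2_int)
        then show ?thesis by simp
      qed
      finally show "exp (- (real_of_int m)\<^sup>2) \<le> (1 / 2) ^ nat \<bar>m\<bar>"
        by (simp add: exp_minus power_one_over field_simps)
    qed
    also have "\<dots> \<le> 3" unfolding sum_half_powers_le by simp
    also have "\<dots> \<le> exp 2" using exp_ge_add_one_self[of 2] by simp
    finally show "(\<Sum>m\<in>?B. exp (- (real_of_int m)\<^sup>2)) \<le> exp 2" .
  qed auto
  also have "(\<Prod>i\<in>{1..n}. exp 2) = exp (2 * real n)"
    by (simp add: mult.commute flip: exp_of_nat_mult)
  finally show "real (card (lattice_ball n)) \<le> exp (6 * real n)"
    by (simp flip: exp_add)
qed

definition light_bound :: "nat \<Rightarrow> real \<Rightarrow> real \<Rightarrow> (nat \<Rightarrow> nat \<Rightarrow> real) \<Rightarrow> (nat \<Rightarrow> nat \<Rightarrow> real) \<Rightarrow> bool" where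
  "light_bound n d r p A \<longleftrightarrow>
    (\<forall>k\<in>lattice_ball n. \<forall>l\<in>lattice_ball n.
      (\<Sum>i\<in>{1..n}. \<Sum>j\<in>{1..n}.
        (if \<bar>real_of_int (k i) * real_of_int (l j)\<bar> \<le> sqrt d
         then real_of_int (k i) * real_of_int (l j) else 0) * (A i j - p i j)) \<le> 80 * r * n * sqrt d)"

lemma prob_not_light_bound:
  fixes d r :: real
  assumes p: "edge_probs n p" and n: "1 \<le> n" and d: "0 < d" and r: "1 \<le> r"
    and q: "\<And>i j. i \<in> {1..n} \<Longrightarrow> j \<in> {1..n} \<Longrightarrow> p i j \<le> d / n"
  shows "measure_pmf.prob (inhom_ER n p) {A. \<not> light_bound n d r p A} \<le> real n powr (- r) / 4"
proof -
  let ?I = "lattice_ball n \<times> lattice_ball n"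
  define c where "c \<kappa> i j = (case \<kappa> of (k, l) \<Rightarrow>
    if \<bar>real_of_int (k i) * real_of_int (l j)\<bar> \<le> sqrt d
    then real_of_int (k i) * real_of_int (l j) else 0)" for \<kappa> :: "(nat \<Rightarrow> int) \<times> (nat \<Rightarrow> int)" and i j
  \<comment> \<open>The cutoff at \<open>sqrt d\<close> is exactly what keeps this below 1/2, as the
    centred tail bound demands.\<close>
  define f where "f \<kappa> i j = c \<kappa> i j / (2 * sqrt d)" for \<kappa> i j
  have "{A. \<not> light_bound n d r p A} \<subseteq>
      {A. \<exists>\<kappa>\<in>?I. 40 * r * n \<le> (\<Sum>i\<in>{1..n}. \<Sum>j\<in>{1..n}. f \<kappa> i j * (A i j - p i j))}"
  proof
    fix A assume "A \<in> {A. \<not> light_bound n d r p A}"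
    then obtain k l where kl: "k \<in> lattice_ball n" "l \<in> lattice_ball n"
      and "80 * r * n * sqrt d < (\<Sum>i\<in>{1..n}. \<Sum>j\<in>{1..n}. c (k, l) i j * (A i j - p i j))"
      unfolding light_bound_def c_def by (auto simp: not_le)
    then have "40 * r * n * (2 * sqrt d) \<le> (\<Sum>i\<in>{1..n}. \<Sum>j\<in>{1..n}. c (k, l) i j * (A i j - p i j))"
      by simp
    then have "40 * r * n \<le> (\<Sum>i\<in>{1..n}. \<Sum>j\<in>{1..n}. c (k, l) i j * (A i j - p i j)) / (2 * sqrt d)"
      using d by (subst pos_le_divide_eq) auto
    then show "A \<in> {A. \<exists>\<kappa>\<in>?I. 40 * r * n \<le> (\<Sum>i\<in>{1..n}. \<Sum>j\<in>{1..n}. f \<kappa> i j * (A i j - p i j))}"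
      using kl by (auto simp: f_def sum_divide_distrib intro!: bexI[of _ "(k, l)"])
  qed
  then have "measure_pmf.prob (inhom_ER n p) {A. \<not> light_bound n d r p A} \<le>
      measure_pmf.prob (inhom_ER n p)
      {A. \<exists>\<kappa>\<in>?I. 40 * r * n \<le> (\<Sum>i\<in>{1..n}. \<Sum>j\<in>{1..n}. f \<kappa> i j * (A i j - p i j))}"
    by (intro measure_pmf.finite_measure_mono) auto
  also have "\<dots> \<le> (\<Sum>\<kappa>\<in>?I. measure_pmf.prob (inhom_ER n p)
      {A. 40 * r * n \<le> (\<Sum>i\<in>{1..n}. \<Sum>j\<in>{1..n}. f \<kappa> i j * (A i j - p i j))})"
    by (intro prob_Bex_le finite_cartesian_product lattice_ball_bound)
  \<comment> \<open>The variance term is twice \<open>(d / n) (4 n) (4 n) / (4 d)\<close>, that is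
    \<open>8 n\<close>. After the \<open>12 n\<close> from the two lattice balls, at least
    \<open>20 r n\<close> of \<open>40 r n\<close> remain.\<close>
  also have "\<dots> \<le> (\<Sum>\<kappa>\<in>?I. exp (8 * n - 40 * r * n))"
  proof (rule sum_mono)
    fix \<kappa> assume \<kappa>: "\<kappa> \<in> ?I"
    obtain k l where [simp]: "\<kappa> = (k, l)" by (cases \<kappa>)
    have k: "(\<Sum>i\<in>{1..n}. (real_of_int (k i))\<^sup>2) \<le> 4 * real n"
      and l: "(\<Sum>i\<in>{1..n}. (real_of_int (l i))\<^sup>2) \<le> 4 * real n"
      using \<kappa> by (auto simp: lattice_ball_def)
    have "\<bar>f \<kappa> i j\<bar> \<le> 1 / 2" for i j
      using d by (auto simp: f_def c_def abs_mult field_simps)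
    then have "measure_pmf.prob (inhom_ER n p)
        {A. 40 * r * n \<le> (\<Sum>i\<in>{1..n}. \<Sum>j\<in>{1..n}. f \<kappa> i j * (A i j - p i j))} \<le>
        exp (2 * (\<Sum>i\<in>{1..n}. \<Sum>j\<in>{1..n}. p i j * (f \<kappa> i j)\<^sup>2) - 40 * r * n)"
      by (intro prob_centered_sum_ge p) auto
    also have "\<dots> \<le> exp (8 * n - 40 * r * n)"
    proof -
      have "(\<Sum>i\<in>{1..n}. \<Sum>j\<in>{1..n}. p i j * (f \<kappa> i j)\<^sup>2) \<le>
          (\<Sum>i\<in>{1..n}. \<Sum>j\<in>{1..n}. d / n * ((real_of_int (k i))\<^sup>2 * (real_of_int (l j))\<^sup>2 / (4 * d)))"
      proof (intro sum_mono mult_mono q)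
        fix i j show "(f \<kappa> i j)\<^sup>2 \<le> (real_of_int (k i))\<^sup>2 * (real_of_int (l j))\<^sup>2 / (4 * d)"
          using d by (auto simp: f_def c_def power_divide power_mult_distrib)
      qed (use d in auto)
      also have "\<dots> = (\<Sum>i\<in>{1..n}. (real_of_int (k i))\<^sup>2) * (\<Sum>i\<in>{1..n}. (real_of_int (l i))\<^sup>2) / (4 * real n)"
        using d by (simp add: sum_product sum_divide_distrib mult.commute)
      also have "\<dots> \<le> (4 * real n) * (4 * real n) / (4 * real n)"
        by (intro divide_right_mono mult_mono k l sum_nonneg) auto
      also have "\<dots> = 4 * n" by simp
      finally show ?thesis by simp
    qed
    finally show "measure_pmf.prob (inhom_ER n p)
        {A. 40 * r * n \<le> (\<Sum>i\<in>{1..n}. \<Sum>j\<in>{1..n}. f \<kappa> i j * (A i j - p i j))} \<le>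
        exp (8 * n - 40 * r * n)" .
  qed
  also have "\<dots> = real (card (lattice_ball n)) * real (card (lattice_ball n)) * exp (8 * n - 40 * r * n)"
    by (simp add: card_cartesian_product)
  also have "\<dots> \<le> exp (6 * real n) * exp (6 * real n) * exp (8 * n - 40 * r * n)"
    by (intro mult_right_mono mult_mono lattice_ball_bound) auto
  also have "\<dots> = exp (20 * n - 40 * r * n)"
    by (simp flip: exp_add)
  also have "\<dots> \<le> exp (- 8 * r * (1 + ln (real n)))"
  proof -
    have "1 + ln (real n) \<le> 2 * n"
      using ln_le_minus_one[of "real n"] n by simp
    then have "r * (1 + ln (real n)) \<le> r * (2 * n)" using r by (intro mult_left_mono) auto
    moreover have "1 * real n \<le> r * n" using r by (intro mult_right_mono) auto
    ultimately show ?thesis by simp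
  qed
  also have "\<dots> \<le> (real n)\<^sup>2 * exp (- 8 * r * (1 + ln (real n)))"
    using n by simp
  also have "\<dots> \<le> real n powr (- r) / 4"
    by (rule union_bound_le_powr[OF n r])
  finally show ?thesis .
qed

section \<open>Orientations of sparse graphs\<close>

text \<open>Greedy degeneracy argument: by averaging, some vertex has degree at most
  \<open>k\<close> inside \<open>S\<close>. All its pairs are directed outwards, and induction
  handles the rest.\<close>

lemma orientation_exists:
  fixes A :: "nat \<Rightarrow> nat \<Rightarrow> real" and k :: real
  assumes "finite S" "\<And>i j. i \<in> S \<Longrightarrow> j \<in> S \<Longrightarrow> 0 \<le> A i j"
    and "\<And>U. U \<subseteq> S \<Longrightarrow> U \<noteq> {} \<Longrightarrow> edge_count A U U \<le> k * card U"
  shows "\<exists>Q \<subseteq> S \<times> S. (\<forall>i\<in>S. (\<Sum>j\<in>S. if (i, j) \<in> Q then A i j else 0) \<le> k) \<and>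
    (\<forall>i\<in>S. \<forall>j\<in>S. (i, j) \<in> Q \<or> (j, i) \<in> Q)"
  using assms
proof (induction S rule: finite_psubset_induct)
  case (psubset S)
  show ?case
  proof (cases "S = {}")
    case False
    have "\<exists>i\<in>S. (\<Sum>j\<in>S. A i j) \<le> k"
    proof (rule ccontr)
      assume "\<not> ?thesis"
      then have "(\<Sum>i\<in>S. k) < edge_count A S S"
        unfolding edge_count_def using False psubset.hyps by (intro sum_strict_mono) auto
      then show False using psubset.prems(2)[of S] False by (simp add: mult.commute)
    qed
    then obtain v where v: "v \<in> S" "(\<Sum>j\<in>S. A v j) \<le> k" by blast
    have "\<exists>Q \<subseteq> (S - {v}) \<times> (S - {v}).
        (\<forall>i\<in>S - {v}. (\<Sum>j\<in>S - {v}. if (i, j) \<in> Q then A i j else 0) \<le> k) \<and>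
        (\<forall>i\<in>S - {v}. \<forall>j\<in>S - {v}. (i, j) \<in> Q \<or> (j, i) \<in> Q)"
      using psubset.prems v by (intro psubset.IH) auto
    then obtain Q where Q: "Q \<subseteq> (S - {v}) \<times> (S - {v})"
      "\<And>i. i \<in> S - {v} \<Longrightarrow> (\<Sum>j\<in>S - {v}. if (i, j) \<in> Q then A i j else 0) \<le> k"
      "\<And>i j. i \<in> S - {v} \<Longrightarrow> j \<in> S - {v} \<Longrightarrow> (i, j) \<in> Q \<or> (j, i) \<in> Q"
      by blast
    let ?Q = "Q \<union> {v} \<times> S"
    have "(\<Sum>j\<in>S. if (i, j) \<in> ?Q then A i j else 0) \<le> k" if i: "i \<in> S" for i
    proof (cases "i = v")
      case True
      then have "(\<Sum>j\<in>S. if (i, j) \<in> ?Q then A i j else 0) = (\<Sum>j\<in>S. A v j)"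
        by (intro sum.cong) auto
      then show ?thesis using v by simp
    next
      case False
      then have "(\<Sum>j\<in>S. if (i, j) \<in> ?Q then A i j else 0) =
          (\<Sum>j\<in>S - {v}. if (i, j) \<in> Q then A i j else 0)"
        using Q(1) psubset.hyps by (intro sum.mono_neutral_cong_right) auto
      then show ?thesis using Q(2)[of i] False i by simp
    qed
    moreover have "?Q \<subseteq> S \<times> S" using Q(1) v by auto
    moreover have "\<forall>i\<in>S. \<forall>j\<in>S. (i, j) \<in> ?Q \<or> (j, i) \<in> ?Q" using Q(3) by blast
    ultimately show ?thesis by (intro exI[of _ ?Q] conjI ballI) auto
  qed auto
qed

text \<open>The vertices with more than \<open>2 * k\<close> neighbours in \<open>H\<close> are fewer than those of \<open>H\<close>,
  since otherwise \<open>H\<close> together with as many of them would be too dense; all other vertices orient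
  their edges to \<open>H\<close> outwards.\<close>

lemma orientation_incident:
  fixes A :: "nat \<Rightarrow> nat \<Rightarrow> real" and k :: real
  assumes V: "finite V" "H \<subseteq> V" and k: "0 \<le> k"
    and A: "\<And>i j. i \<in> V \<Longrightarrow> j \<in> V \<Longrightarrow> 0 \<le> A i j"
    and sparse: "\<And>U. U \<subseteq> V \<Longrightarrow> U \<noteq> {} \<Longrightarrow> card U \<le> 2 * card H \<Longrightarrow> edge_count A U U \<le> k * card U"
  shows "\<exists>Q. (\<forall>i\<in>V. (\<Sum>j\<in>V. if (i, j) \<in> Q then A i j else 0) \<le> 2 * k) \<and>
    (\<forall>i\<in>H. \<forall>j\<in>V. (i, j) \<in> Q \<or> (j, i) \<in> Q)"
proof -
  define T where "T = {v \<in> V - H. 2 * k < (\<Sum>h\<in>H. A v h)}"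
  have fin: "finite H" "finite T" using V finite_subset by (auto simp: T_def)
  have TV: "T \<subseteq> V" "T \<inter> H = {}" by (auto simp: T_def)
  have card_T: "card T \<le> card H"
  proof (rule ccontr)
    assume "\<not> ?thesis"
    then have "card H \<le> card T" "T \<noteq> {}" by auto
    then have "H \<noteq> {}" using k by (auto simp: T_def)
    obtain T' where T': "T' \<subseteq> T" "card T' = card H" "finite T'"
      using obtain_subset_with_card_n[OF \<open>card H \<le> card T\<close>] by blast
    have "T' \<noteq> {}" using T' \<open>H \<noteq> {}\<close> fin by auto
    have card_U: "card (H \<union> T') = 2 * card H"
      using T' TV fin by (subst card_Un_disjoint) auto
    have "2 * k * card H = (\<Sum>v\<in>T'. 2 * k)" using T' by simp
    also have "\<dots> < (\<Sum>v\<in>T'. \<Sum>h\<in>H. A v h)"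
      using T' \<open>T' \<noteq> {}\<close> by (intro sum_strict_mono) (auto simp: T_def)
    also have "\<dots> \<le> (\<Sum>v\<in>T'. \<Sum>h\<in>H \<union> T'. A v h)"
      using T' TV V fin by (intro sum_mono sum_mono2 A) auto
    also have "\<dots> \<le> edge_count A (H \<union> T') (H \<union> T')"
      unfolding edge_count_def using T' TV V fin by (intro sum_mono2 sum_nonneg A) auto
    also have "\<dots> \<le> k * card (H \<union> T')"
      using T' TV V \<open>H \<noteq> {}\<close> card_U by (intro sparse) auto
    finally show False by (simp add: card_U)
  qed
  define S where "S = H \<union> T"
  have S: "S \<subseteq> V" "finite S" "H \<subseteq> S" using V TV fin by (auto simp: S_def)
  have card_S: "card S \<le> 2 * card H"
    using card_Un_le[of H T] card_T by (simp add: S_def)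
  have "\<exists>Q \<subseteq> S \<times> S. (\<forall>i\<in>S. (\<Sum>j\<in>S. if (i, j) \<in> Q then A i j else 0) \<le> k) \<and>
      (\<forall>i\<in>S. \<forall>j\<in>S. (i, j) \<in> Q \<or> (j, i) \<in> Q)"
  proof (intro orientation_exists sparse)
    fix U assume "U \<subseteq> S"
    then show "card U \<le> 2 * card H" using card_mono[of S U] S card_S by linarith
  qed (use S in \<open>auto intro!: A\<close>)
  then obtain Q where Q: "Q \<subseteq> S \<times> S"
    "\<And>i. i \<in> S \<Longrightarrow> (\<Sum>j\<in>S. if (i, j) \<in> Q then A i j else 0) \<le> k"
    "\<And>i j. i \<in> S \<Longrightarrow> j \<in> S \<Longrightarrow> (i, j) \<in> Q \<or> (j, i) \<in> Q"
    by blast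
  let ?Q = "Q \<union> (V - S) \<times> H"
  have "(\<Sum>j\<in>V. if (i, j) \<in> ?Q then A i j else 0) \<le> 2 * k" if i: "i \<in> V" for i
  proof (cases "i \<in> S")
    case True
    then have "(\<Sum>j\<in>V. if (i, j) \<in> ?Q then A i j else 0) =
        (\<Sum>j\<in>S. if (i, j) \<in> Q then A i j else 0)"
      using Q(1) S V by (intro sum.mono_neutral_cong_right) auto
    then show ?thesis using Q(2)[OF True] k by simp
  next
    case False
    then have "(\<Sum>j\<in>V. if (i, j) \<in> ?Q then A i j else 0) = (\<Sum>j\<in>H. A i j)"
      using Q(1) S V i by (intro sum.mono_neutral_cong_right) auto
    also have "\<dots> \<le> 2 * k" using False i by (auto simp: S_def T_def not_less)
    finally show ?thesis .
  qed
  moreover have "\<forall>i\<in>H. \<forall>j\<in>V. (i, j) \<in> ?Q \<or> (j, i) \<in> ?Q" using Q(3) S by blast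
  ultimately show ?thesis by blast
qed

text \<open>As \<open>A\<close> is 0/1-valued, \<open>B = A B\<close> entrywise, so an oriented term
  splits as \<open>(A x) (B y)\<close>. Cauchy--Schwarz over all pairs sees only out-degrees of
  \<open>A\<close> in the first factor and only column norms of \<open>B\<close> in the
  second.\<close>

lemma oriented_bilinear_le:
  fixes A B :: "nat \<Rightarrow> nat \<Rightarrow> real"
  assumes V: "finite V"
    and A: "\<And>i j. i \<in> V \<Longrightarrow> j \<in> V \<Longrightarrow> A i j \<in> {0, 1}"
    and B: "\<And>i j. i \<in> V \<Longrightarrow> j \<in> V \<Longrightarrow> 0 \<le> B i j \<and> B i j \<le> A i j"
    and D: "\<And>j. j \<in> V \<Longrightarrow> (\<Sum>i\<in>V. (B i j)\<^sup>2) \<le> D"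
    and Q: "\<And>i. i \<in> V \<Longrightarrow> (\<Sum>j\<in>V. if (i, j) \<in> Q then A i j else 0) \<le> k"
    and xy: "\<And>i. i \<in> V \<Longrightarrow> 0 \<le> x i" "\<And>i. i \<in> V \<Longrightarrow> 0 \<le> y i"
  shows "(\<Sum>i\<in>V. \<Sum>j\<in>V. if (i, j) \<in> Q then B i j * x i * y j else 0) \<le>
    sqrt (k * (\<Sum>i\<in>V. (x i)\<^sup>2)) * sqrt (D * (\<Sum>i\<in>V. (y i)\<^sup>2))"
proof -
  define f where "f = (\<lambda>(i, j). if (i, j) \<in> Q then A i j * x i else 0)"
  define g where "g = (\<lambda>(i, j). B i j * y j)"
  have "(\<Sum>e\<in>V \<times> V. (f e)\<^sup>2) = (\<Sum>i\<in>V. \<Sum>j\<in>V. (f (i, j))\<^sup>2)"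
    by (simp add: sum.cartesian_product)
  also have "\<dots> = (\<Sum>i\<in>V. (\<Sum>j\<in>V. if (i, j) \<in> Q then A i j else 0) * (x i)\<^sup>2)"
    unfolding sum_distrib_right using A by (intro sum.cong) (fastforce simp: f_def power_mult_distrib)+
  also have "\<dots> \<le> (\<Sum>i\<in>V. k * (x i)\<^sup>2)"
    by (intro sum_mono mult_right_mono Q) auto
  finally have f_le: "(\<Sum>e\<in>V \<times> V. (f e)\<^sup>2) \<le> k * (\<Sum>i\<in>V. (x i)\<^sup>2)"
    by (simp add: sum_distrib_left)
  have "(\<Sum>e\<in>V \<times> V. (g e)\<^sup>2) = (\<Sum>i\<in>V. \<Sum>j\<in>V. (g (i, j))\<^sup>2)"
    by (simp add: sum.cartesian_product)
  also have "\<dots> = (\<Sum>j\<in>V. \<Sum>i\<in>V. (g (i, j))\<^sup>2)" by (rule sum.swap)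
  also have "\<dots> = (\<Sum>j\<in>V. (\<Sum>i\<in>V. (B i j)\<^sup>2) * (y j)\<^sup>2)"
    by (simp add: g_def power_mult_distrib sum_distrib_right)
  also have "\<dots> \<le> (\<Sum>j\<in>V. D * (y j)\<^sup>2)"
    by (intro sum_mono mult_right_mono D) auto
  finally have g_le: "(\<Sum>e\<in>V \<times> V. (g e)\<^sup>2) \<le> D * (\<Sum>i\<in>V. (y i)\<^sup>2)"
    by (simp add: sum_distrib_left)
  have "(\<Sum>i\<in>V. \<Sum>j\<in>V. if (i, j) \<in> Q then B i j * x i * y j else 0) =
      (\<Sum>e\<in>V \<times> V. \<bar>f e\<bar> * \<bar>g e\<bar>)"
    unfolding sum.cartesian_product
  proof (rule sum.cong)
    fix e assume "e \<in> V \<times> V"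
    then obtain i j where [simp]: "e = (i, j)" and ij: "i \<in> V" "j \<in> V" by auto
    have "B i j = A i j * B i j" using A[OF ij] B[OF ij] by auto
    then show "(case e of (i, j) \<Rightarrow> if (i, j) \<in> Q then B i j * x i * y j else 0) = \<bar>f e\<bar> * \<bar>g e\<bar>"
      using A[OF ij] B[OF ij] xy(1)[OF ij(1)] xy(2)[OF ij(2)] by (auto simp: f_def g_def abs_mult)
  qed simp
  also have "\<dots> \<le> L2_set f (V \<times> V) * L2_set g (V \<times> V)"
    by (rule L2_set_mult_ineq)
  also have "\<dots> \<le> sqrt (k * (\<Sum>i\<in>V. (x i)\<^sup>2)) * sqrt (D * (\<Sum>i\<in>V. (y i)\<^sup>2))"
    unfolding L2_set_def
    by (intro mult_mono real_sqrt_le_mono f_le g_le real_sqrt_ge_zero order_trans[OF _ f_le] sum_nonneg) auto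
  finally show ?thesis .
qed

section \<open>Heavy pairs\<close>

lemma sum_powers2_le:
  fixes Y :: real
  assumes "0 \<le> Y"
  shows "(\<Sum>a<m. if 2 ^ a \<le> Y then 2 ^ a else 0) \<le> 2 * Y"
proof -
  \<comment> \<open>The minimum carries the induction: a term \<open>2 ^ m\<close> is added only if
    \<open>2 ^ m <= Y\<close>, and then the new sum is at most
    \<open>2 ^ Suc m <= 2 Y\<close>.\<close>
  have "(\<Sum>a<m. if 2 ^ a \<le> Y then 2 ^ a else 0) \<le> min (2 ^ m) (2 * Y)"
    using assms by (induction m) auto
  then show ?thesis by simp
qed

text \<open>Here \<open>s\<close>, \<open>t\<close> are the sizes of two dyadic level sets with levels \<open>P = 2 ^ a\<close>, \<open>R = 2 ^ b\<close>,
  \<open>e\<close> is the number of edges between them, and \<open>w = sqrt d\<close>.  Each of the three terms on the right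
  stays bounded when summed over all levels.\<close>

lemma heavy_pair_le:
  fixes e s t w r P R \<mu> :: real and n :: nat
  assumes pos: "0 < s" "0 < t" "t \<le> real n" "0 < w" "1 \<le> r"
    and P: "1 \<le> P" and R: "1 = R \<or> 2 \<le> R"
    and e: "0 \<le> e"
    and heavy: "w \<le> 4 * (P * R)"
    and \<mu>: "\<mu> = w\<^sup>2 * s * t / n"
    and disc: "e \<le> 9 * \<mu> \<or> e * ln (e / \<mu>) \<le> 40 * r * subset_entropy n t"
  shows "e * P * R \<le> 320 * r * n * w * ((s * P\<^sup>2 / n) * (t * R\<^sup>2 / n) +
    P / (R * w) * (t * R\<^sup>2 / n + 1 / R) + (if P \<le> w then P / w * (t * R\<^sup>2 / n) else 0))"
    (is "_ \<le> 320 * r * n * w * (?X + ?Y * (?\<beta> + 1 / R) + ?Z)")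
proof -
  have n: "0 < real n" using pos by linarith
  have R1: "1 \<le> R" using R by auto
  have nonneg: "0 \<le> ?X" "0 \<le> ?Y" "0 \<le> ?\<beta>" "0 \<le> ?Z" "0 \<le> 1 / R"
    using pos P R1 by auto
  have \<mu>_pos: "0 < \<mu>" using pos n by (simp add: \<mu>)
  have scale: "c * real n * w * T \<le> 320 * r * n * w * (?X + ?Y * (?\<beta> + 1 / R) + ?Z)"
    if "c \<le> 320 * r" "0 \<le> T" "T \<le> ?X + ?Y * (?\<beta> + 1 / R) + ?Z" for c T
    using that pos n by (intro mult_mono) auto
  have "x \<le> x + y * (b + c) + z \<and> y * c \<le> x + y * (b + c) + z \<and>
      y * b \<le> x + y * (b + c) + z \<and> z \<le> x + y * (b + c) + z"
    if "0 \<le> x" "0 \<le> y" "0 \<le> b" "0 \<le> c" "0 \<le> z" for x y b c z :: real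
    using that by (simp add: distrib_left)
  from this[OF nonneg(1-3,5,4)]
  have le: "?X \<le> ?X + ?Y * (?\<beta> + 1 / R) + ?Z" "?Y * (1 / R) \<le> ?X + ?Y * (?\<beta> + 1 / R) + ?Z"
    "?Y * ?\<beta> \<le> ?X + ?Y * (?\<beta> + 1 / R) + ?Z" "?Z \<le> ?X + ?Y * (?\<beta> + 1 / R) + ?Z"
    by blast+
  have c: "36 \<le> 320 * r" "80 * r \<le> 320 * r" "240 * r \<le> 320 * r" "120 * r \<le> 320 * r" "1 \<le> 320 * r"
    using pos by auto
  show ?thesis
  proof (cases "e \<le> 9 * \<mu>")
    \<comment> \<open>Heaviness trades one factor \<open>w\<close> for \<open>4 P R\<close>, which
      turns a mean-sized count into \<open>?X\<close>.\<close>
    case True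
    have "e * P * R \<le> 9 * \<mu> * P * R"
      using True P R1 by (intro mult_right_mono) auto
    also have "\<dots> = 9 * (w * s * t * P * R / n) * w"
      by (simp add: \<mu> power2_eq_square)
    also have "\<dots> \<le> 9 * (w * s * t * P * R / n) * (4 * (P * R))"
      using pos P R1 n heavy by (intro mult_left_mono) auto
    also have "\<dots> = 36 * real n * w * ?X"
      using n by (simp add: power2_eq_square)
    also have "\<dots> \<le> 320 * r * n * w * (?X + ?Y * (?\<beta> + 1 / R) + ?Z)"
      by (intro scale c le nonneg)
    finally show ?thesis .
  next
    case False
    define L where "L = ln (e / \<mu>)"
    have eL: "e * L \<le> 40 * r * subset_entropy n t" using disc False by (simp add: L_def)
    have "9 \<le> e / \<mu>" using False \<mu>_pos by (simp add: pos_le_divide_eq)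
    then have L2: "2 \<le> L"
      using exp_2_le_9 unfolding L_def by (subst ln_ge_iff) auto
    have e2: "e * 2 \<le> e * L" using L2 e by (rule mult_left_mono)
    show ?thesis
    proof (cases "t * R ^ 4 \<le> n")
      \<comment> \<open>The level is small: by monotonicity its entropy is at most that of size
        \<open>n / R ^ 4\<close>, where \<open>1 + ln (R ^ 4) <= 4 R\<close>. The fourth power is
        chosen so that the summable \<open>?Y / R\<close> remains.\<close>
      case True
      have "ln R \<le> R - 1" using R1 by (intro ln_le_minus_one) auto
      then have lnR: "1 + ln (R ^ 4) \<le> 4 * R" using R1 by (simp add: ln_realpow)
      have "subset_entropy n t \<le> subset_entropy n (n / R ^ 4)"
        using True pos R1 by (intro subset_entropy_mono) (auto simp: field_simps)
      also have "\<dots> = n / R ^ 4 * (1 + ln (R ^ 4))"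
        using n R1 by (simp add: subset_entropy_def)
      also have "\<dots> \<le> n / R ^ 4 * (4 * R)"
        using n R1 lnR by (intro mult_left_mono) auto
      also have "\<dots> = 4 * real n / R ^ 3"
        using R1 by (simp add: power_numeral_reduce)
      finally have "40 * r * subset_entropy n t \<le> 40 * r * (4 * real n / R ^ 3)"
        using pos by (intro mult_left_mono) auto
      moreover have "40 * r * (4 * real n / R ^ 3) = 2 * (80 * r * n / R ^ 3)" by simp
      ultimately have "e * 2 \<le> 2 * (80 * r * n / R ^ 3)" using eL e2 by linarith
      then have "e \<le> 80 * r * n / R ^ 3" by simp
      then have "e * P * R \<le> 80 * r * n / R ^ 3 * P * R"
        using P R1 by (intro mult_right_mono) auto
      also have "\<dots> = 80 * r * n * w * (?Y * (1 / R))"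
        using R1 pos by (simp add: field_simps power_numeral_reduce)
      also have "\<dots> \<le> 320 * r * n * w * (?X + ?Y * (?\<beta> + 1 / R) + ?Z)"
        by (intro scale c le mult_nonneg_nonneg nonneg)
      finally show ?thesis .
    next
      case F: False
      \<comment> \<open>The gap between 1 and 2 in the levels keeps \<open>ln R\<close> away from 0,
        so the entropy is at most \<open>6 t ln R\<close>.\<close>
      then have "R \<noteq> 1" using pos by auto
      then have "2 \<le> R" using R by auto
      then have "ln 2 \<le> ln R" by simp
      then have lnR: "1 \<le> 2 * ln R" using ln2_ge_two_thirds by linarith
      have "ln (n / t) \<le> ln (R ^ 4)"
        using F pos n R1 by (intro ln_mono) (auto simp: field_simps)
      then have "1 + ln (n / t) \<le> 6 * ln R" using lnR R1 by (simp add: ln_realpow)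
      then have "subset_entropy n t \<le> t * (6 * ln R)"
        unfolding subset_entropy_def using pos by (intro mult_left_mono) auto
      then have "40 * r * subset_entropy n t \<le> 40 * r * (t * (6 * ln R))"
        using pos by (intro mult_left_mono) auto
      then have eL': "e * L \<le> 240 * r * t * ln R" using eL by simp
      show ?thesis
      proof (cases "R \<le> e / \<mu>")
        \<comment> \<open>A large ratio \<open>e / \<mu>\<close> cancels \<open>ln R\<close> on both
          sides and leaves \<open>e\<close> of order \<open>r t\<close>.\<close>
        case True
        then have "ln R \<le> L" unfolding L_def using R1 by (intro ln_mono) auto
        then have "e * ln R \<le> e * L" using e by (intro mult_left_mono)
        then have "e * ln R \<le> (240 * r * t) * ln R" using eL' by linarith
        then have "e \<le> 240 * r * t" using lnR by (subst (asm) mult_le_cancel_right_pos) auto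
        then have "e * P * R \<le> 240 * r * t * P * R"
          using P R1 by (intro mult_right_mono) auto
        also have "\<dots> = 240 * r * n * w * (?Y * ?\<beta>)"
          using R1 pos n by (simp add: field_simps power2_eq_square)
        also have "\<dots> \<le> 320 * r * n * w * (?X + ?Y * (?\<beta> + 1 / R) + ?Z)"
          by (intro scale c le mult_nonneg_nonneg nonneg)
        finally show ?thesis .
      next
        case eR: False
        then have eR: "e \<le> R * \<mu>" using \<mu>_pos by (simp add: not_le pos_divide_less_eq)
        show ?thesis
        proof (cases "P \<le> w")
          \<comment> \<open>\<open>L >= 2\<close> and \<open>ln R <= R\<close> cost an extra factor
            \<open>R\<close>; the cutoff \<open>P <= w\<close> makes the result summable over the
            levels \<open>P\<close>.\<close>
          case True
          have "ln R \<le> R" using ln_le_minus_one[of R] R1 by simp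
          then have "240 * r * t * ln R \<le> 240 * r * t * R"
            using pos by (intro mult_left_mono) auto
          then have "e \<le> 120 * r * t * R" using eL' e2 by linarith
          then have "e * P * R \<le> 120 * r * t * R * P * R"
            using P R1 by (intro mult_right_mono) auto
          also have "\<dots> = 120 * r * n * w * ?Z"
            using True R1 pos n by (simp add: power2_eq_square)
          also have "\<dots> \<le> 320 * r * n * w * (?X + ?Y * (?\<beta> + 1 / R) + ?Z)"
            by (intro scale c le nonneg)
          finally show ?thesis .
        next
          case False
          \<comment> \<open>Here \<open>e <= R \<mu>\<close> suffices, since \<open>w < P\<close>
            trades a factor \<open>w\<close> for \<open>P\<close>.\<close>
          have "e * P * R \<le> R * \<mu> * P * R"
            using eR P R1 by (intro mult_right_mono) auto
          also have "\<dots> = (w * s * t * P * R\<^sup>2 / n) * w"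
            by (simp add: \<mu> power2_eq_square)
          also have "\<dots> \<le> (w * s * t * P * R\<^sup>2 / n) * P"
            using pos P R1 n False by (intro mult_left_mono) auto
          also have "\<dots> = 1 * real n * w * ?X"
            using n by (simp add: power2_eq_square)
          also have "\<dots> \<le> 320 * r * n * w * (?X + ?Y * (?\<beta> + 1 / R) + ?Z)"
            by (intro scale c le nonneg)
          finally show ?thesis .
        qed
      qed
    qed
  qed
qed

text \<open>\<open>\<alpha>\<close> and \<open>\<beta>\<close> are normalised level energies with
  totals at most 4. The side condition \<open>2 ^ a <= 2 w 2 ^ b\<close> makes the middle term of
  the pair bound a geometric sum in \<open>a\<close>. The three terms sum to 16, 24 and 8, and 320
  times 48 is 15360.\<close>

lemma heavy_dyadic_le:
  fixes d r :: real and S T :: "nat \<Rightarrow> nat set"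
  assumes n: "1 \<le> n" and d: "0 < d" and r: "1 \<le> r"
    and disc: "discrepancy_bound n d r A"
    and A: "\<And>i j. i \<in> {1..n} \<Longrightarrow> j \<in> {1..n} \<Longrightarrow> 0 \<le> A i j"
    and S: "\<And>a. S a \<subseteq> {1..n}" "(\<Sum>a<m. real (card (S a)) * 4 ^ a) \<le> 4 * real n"
    and T: "\<And>b. T b \<subseteq> {1..n}" "(\<Sum>b<m. real (card (T b)) * 4 ^ b) \<le> 4 * real n"
  shows "(\<Sum>a<m. \<Sum>b<m. if card (S a) \<le> card (T b) \<and> 2 ^ a \<le> 2 * sqrt d * 2 ^ b \<and>
      sqrt d \<le> 4 * (2 ^ a * 2 ^ b) then edge_count A (S a) (T b) * 2 ^ a * 2 ^ b else 0)
    \<le> 15360 * r * n * sqrt d"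
proof -
  define w where "w = sqrt d"
  have w: "0 < w" "w\<^sup>2 = d" using d by (auto simp: w_def)
  define \<alpha> where "\<alpha> a = real (card (S a)) * 4 ^ a / real n" for a
  define \<beta> where "\<beta> b = real (card (T b)) * 4 ^ b / real n" for b
  have \<alpha>: "0 \<le> \<alpha> a" "(\<Sum>a<m. \<alpha> a) \<le> 4" for a
    using S(2) n by (auto simp: \<alpha>_def simp flip: sum_divide_distrib) (simp add: field_simps)
  have \<beta>: "0 \<le> \<beta> b" "(\<Sum>b<m. \<beta> b) \<le> 4" for b
    using T(2) n by (auto simp: \<beta>_def simp flip: sum_divide_distrib) (simp add: field_simps)
  let ?u = "\<lambda>a b. (if 2 ^ a \<le> 2 * w * 2 ^ b then 2 ^ a else 0) * ((\<beta> b + 1 / 2 ^ b) / (2 ^ b * w))"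
  let ?v = "\<lambda>a b. (if 2 ^ a \<le> w then 2 ^ a else 0) * (\<beta> b / w)"
  have pair: "(if card (S a) \<le> card (T b) \<and> 2 ^ a \<le> 2 * w * 2 ^ b \<and>
      w \<le> 4 * (2 ^ a * 2 ^ b) then edge_count A (S a) (T b) * 2 ^ a * 2 ^ b else 0) \<le>
    320 * r * n * w * (\<alpha> a * \<beta> b + ?u a b + ?v a b)" for a b
  proof -
    have nonneg: "0 \<le> 320 * r * n * w * (\<alpha> a * \<beta> b + ?u a b + ?v a b)"
      using r w \<alpha>(1) \<beta>(1) by (intro mult_nonneg_nonneg add_nonneg_nonneg) auto
    show ?thesis
    proof (cases "S a \<noteq> {} \<and> card (S a) \<le> card (T b) \<and> 2 ^ a \<le> 2 * w * 2 ^ b \<and>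
        w \<le> 4 * (2 ^ a * 2 ^ b)")
      case True
      have fin: "finite (S a)" "finite (T b)" using finite_subset[OF S(1)] finite_subset[OF T(1)] by auto
      have s: "0 < card (S a)" using True fin by (simp add: card_gt_0_iff)
      have t: "0 < card (T b)" "card (T b) \<le> n"
        using True s card_mono[OF _ T(1)[of b]] by auto
      have "edge_count A (S a) (T b) * 2 ^ a * 2 ^ b \<le> 320 * r * n * w *
          ((real (card (S a)) * (2 ^ a)\<^sup>2 / n) * (real (card (T b)) * (2 ^ b)\<^sup>2 / n) +
          2 ^ a / (2 ^ b * w) * (real (card (T b)) * (2 ^ b)\<^sup>2 / n + 1 / 2 ^ b) +
          (if 2 ^ a \<le> w then 2 ^ a / w * (real (card (T b)) * (2 ^ b)\<^sup>2 / n) else 0))"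
      proof (rule heavy_pair_le[OF _ _ _ w(1) r _ _ _ _ refl])
        show "1 = (2::real) ^ b \<or> 2 \<le> (2::real) ^ b"
          by (cases b) (auto simp: self_le_power)
        show "0 \<le> edge_count A (S a) (T b)"
          unfolding edge_count_def using S(1) T(1) by (intro sum_nonneg A) blast+
        show "edge_count A (S a) (T b) \<le> 9 * (w\<^sup>2 * real (card (S a)) * card (T b) / n) \<or>
          edge_count A (S a) (T b) * ln (edge_count A (S a) (T b) / (w\<^sup>2 * real (card (S a)) * card (T b) / n))
            \<le> 40 * r * subset_entropy n (card (T b))"
          using disc S(1)[of a] T(1)[of b] True unfolding discrepancy_bound_def Let_def w(2) by blast
      qed (use s t True in auto)
      moreover have "((2::real) ^ c)\<^sup>2 = 4 ^ c" for c
        by (simp add: power2_eq_square flip: power_mult_distrib)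
      ultimately show ?thesis
        using True by (cases "2 ^ a \<le> w") (simp_all add: \<alpha>_def \<beta>_def mult_ac)
    next
      case False
      then have "(if card (S a) \<le> card (T b) \<and> 2 ^ a \<le> 2 * w * 2 ^ b \<and>
          w \<le> 4 * (2 ^ a * 2 ^ b) then edge_count A (S a) (T b) * 2 ^ a * 2 ^ b else 0) = 0"
        by (auto simp: edge_count_def)
      then show ?thesis using nonneg by linarith
    qed
  qed
  have "(\<Sum>a<m. \<Sum>b<m. if card (S a) \<le> card (T b) \<and> 2 ^ a \<le> 2 * w * 2 ^ b \<and>
      w \<le> 4 * (2 ^ a * 2 ^ b) then edge_count A (S a) (T b) * 2 ^ a * 2 ^ b else 0) \<le>
    (\<Sum>a<m. \<Sum>b<m. 320 * r * n * w * (\<alpha> a * \<beta> b + ?u a b + ?v a b))"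
    by (intro sum_mono pair)
  also have "\<dots> = 320 * r * n * w * ((\<Sum>a<m. \<Sum>b<m. \<alpha> a * \<beta> b) + (\<Sum>a<m. \<Sum>b<m. ?u a b)
      + (\<Sum>a<m. \<Sum>b<m. ?v a b))"
    by (simp only: sum.distrib sum_distrib_left[symmetric])
  also have "\<dots> \<le> 320 * r * n * w * (16 + 24 + 8)"
  proof (intro mult_left_mono add_mono)
    have "(\<Sum>a<m. \<Sum>b<m. \<alpha> a * \<beta> b) = (\<Sum>a<m. \<alpha> a) * (\<Sum>b<m. \<beta> b)"
      by (simp add: sum_product)
    also have "\<dots> \<le> 4 * 4"
      using \<alpha> \<beta> by (intro mult_mono sum_nonneg) auto
    finally show "(\<Sum>a<m. \<Sum>b<m. \<alpha> a * \<beta> b) \<le> 16" by simp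
    have "(\<Sum>a<m. \<Sum>b<m. ?u a b) = (\<Sum>b<m. (\<Sum>a<m. if 2 ^ a \<le> 2 * w * 2 ^ b then 2 ^ a else 0)
        * ((\<beta> b + 1 / 2 ^ b) / (2 ^ b * w)))"
      by (subst sum.swap) (simp only: sum_distrib_right)
    also have "\<dots> \<le> (\<Sum>b<m. 2 * (2 * w * 2 ^ b) * ((\<beta> b + 1 / 2 ^ b) / (2 ^ b * w)))"
      using w \<beta>(1) by (intro sum_mono mult_right_mono sum_powers2_le) auto
    also have "\<dots> = 4 * ((\<Sum>b<m. \<beta> b) + (\<Sum>b<m. (1 / 2) ^ b))"
      using w by (simp add: sum_distrib_left power_one_over flip: sum.distrib)
    also have "\<dots> \<le> 4 * (4 + 2)"
    proof (intro mult_left_mono add_mono \<beta>(2))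
      show "(\<Sum>b<m. (1 / 2 :: real) ^ b) \<le> 2" by (simp add: geometric_sum)
    qed auto
    finally show "(\<Sum>a<m. \<Sum>b<m. ?u a b) \<le> 24" by simp
    have "(\<Sum>a<m. \<Sum>b<m. ?v a b) = (\<Sum>a<m. if 2 ^ a \<le> w then 2 ^ a else 0) * (\<Sum>b<m. \<beta> b / w)"
      by (simp only: sum_product)
    also have "\<dots> \<le> (2 * w) * (4 / w)"
      using w \<beta> by (intro mult_mono sum_powers2_le sum_nonneg)
        (auto simp: divide_right_mono simp flip: sum_divide_distrib)
    also have "\<dots> = 8" using w by simp
    finally show "(\<Sum>a<m. \<Sum>b<m. ?v a b) \<le> 8" .
  qed (use r w in auto)
  finally show ?thesis by (simp add: w_def)
qed

lemma dyadic_sum_le: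
  fixes u :: "nat \<Rightarrow> nat"
  assumes "finite W"
  shows "(\<Sum>a<m. real (card {i\<in>W. 2 ^ a \<le> u i \<and> u i < 2 ^ Suc a}) * 4 ^ a) \<le> (\<Sum>i\<in>W. (real (u i))\<^sup>2)"
proof -
  define S where "S a = {i\<in>W. 2 ^ a \<le> u i \<and> u i < 2 ^ Suc a}" for a
  have disj: "S a \<inter> S b = {}" if "a \<noteq> b" for a b
  proof -
    have "\<not> (2 ^ a \<le> k \<and> k < 2 ^ Suc a \<and> 2 ^ b \<le> k \<and> k < (2::nat) ^ Suc b)" for k
    proof
      assume *: "2 ^ a \<le> k \<and> k < 2 ^ Suc a \<and> 2 ^ b \<le> k \<and> k < (2::nat) ^ Suc b"
      then have "(2::nat) ^ a < 2 ^ Suc b" "(2::nat) ^ b < 2 ^ Suc a" by linarith+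
      then have "a < Suc b" "b < Suc a" by (simp_all only: power_strict_increasing_iff one_less_numeral_iff semiring_norm)
      then show False using that by simp
    qed
    then show ?thesis by (auto simp: S_def)
  qed
  have "(\<Sum>a<m. real (card (S a)) * 4 ^ a) = (\<Sum>a<m. \<Sum>i\<in>S a. 4 ^ a)"
    by simp
  also have "\<dots> \<le> (\<Sum>a<m. \<Sum>i\<in>S a. (real (u i))\<^sup>2)"
  proof (intro sum_mono)
    fix a i assume "i \<in> S a"
    then have "2 ^ a \<le> u i" by (simp add: S_def)
    then have "real (2 ^ a) \<le> real (u i)" by (simp only: of_nat_le_iff)
    then have "(real (2 ^ a))\<^sup>2 \<le> (real (u i))\<^sup>2" by (intro power_mono) auto
    moreover have "(real (2 ^ a))\<^sup>2 = 4 ^ a" by (simp add: power2_eq_square flip: power_mult_distrib)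
    ultimately show "4 ^ a \<le> (real (u i))\<^sup>2" by (simp only:)
  qed
  also have "\<dots> = (\<Sum>i\<in>(\<Union>a\<in>{..<m}. S a). (real (u i))\<^sup>2)"
    using assms disj by (intro sum.UNION_disjoint[symmetric]) (auto simp: S_def)
  also have "\<dots> \<le> (\<Sum>i\<in>W. (real (u i))\<^sup>2)"
    using assms by (intro sum_mono2) (auto simp: S_def)
  finally show ?thesis by (simp add: S_def)
qed

text \<open>When \<open>u i\<close> and \<open>v j\<close> differ by a factor of at least \<open>sqrt d\<close>, the degree bound alone suffices.
  The other pairs are grouped by dyadic levels.\<close>

lemma heavy_sum_le:
  fixes d r :: real and u v :: "nat \<Rightarrow> nat"
  assumes n: "1 \<le> n" and d: "0 < d" and r: "1 \<le> r"
    and disc: "discrepancy_bound n d r A"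
    and A: "\<And>i j. i \<in> {1..n} \<Longrightarrow> j \<in> {1..n} \<Longrightarrow> 0 \<le> A i j"
    and sym: "\<And>i j. i \<in> {1..n} \<Longrightarrow> j \<in> {1..n} \<Longrightarrow> A i j = A j i"
    and W: "W \<subseteq> {1..n}"
    and deg: "\<And>i. i \<in> W \<Longrightarrow> (\<Sum>j\<in>{1..n}. A i j) \<le> 80 * r * d"
    and u: "(\<Sum>i\<in>W. (real (u i))\<^sup>2) \<le> 4 * real n"
    and v: "(\<Sum>i\<in>W. (real (v i))\<^sup>2) \<le> 4 * real n"
  shows "(\<Sum>i\<in>W. \<Sum>j\<in>W. if sqrt d < real (u i) * real (v j) then A i j * (real (u i) * real (v j)) else 0)
    \<le> 123520 * r * n * sqrt d"
proof -
  define w where "w = sqrt d"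
  have w: "0 < w" "w * w = d" using d by (auto simp: w_def)
  have finW: "finite W" using W finite_subset by blast
  \<comment> \<open>A crude number of levels suffices:
    \<open>a < 2 ^ a <= f i <= (f i)^2 <= 4 n\<close> for an occupied level
    \<open>a\<close>.\<close>
  define m where "m = 4 * n"
  define S where "S a = {i\<in>W. 2 ^ a \<le> u i \<and> u i < 2 ^ Suc a}" for a
  define T where "T b = {i\<in>W. 2 ^ b \<le> v i \<and> v i < 2 ^ Suc b}" for b
  have ST: "S a \<subseteq> {1..n}" "T a \<subseteq> {1..n}" for a using W by (auto simp: S_def T_def)
  have S4: "(\<Sum>a<m. real (card (S a)) * 4 ^ a) \<le> 4 * real n"
    using order_trans[OF dyadic_sum_le[OF finW] u] by (simp add: S_def)
  have T4: "(\<Sum>a<m. real (card (T a)) * 4 ^ a) \<le> 4 * real n"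
    using order_trans[OF dyadic_sum_le[OF finW] v] by (simp add: T_def)
  have level: "\<exists>a<m. 2 ^ a \<le> f i \<and> f i < 2 ^ Suc a"
    if "i \<in> W" "0 < f i" "(\<Sum>i\<in>W. (real (f i))\<^sup>2) \<le> 4 * real n" for i and f :: "nat \<Rightarrow> nat"
  proof -
    have "1 \<le> f i" using that by simp
    then obtain a where a: "2 ^ a \<le> f i" "f i < 2 ^ (a + 1)"
      using ex_power_ivl1[of 2 "f i"] by auto
    have "(real (f i))\<^sup>2 \<le> (\<Sum>i\<in>W. (real (f i))\<^sup>2)"
      using that finW by (intro member_le_sum) auto
    then have "real ((f i)\<^sup>2) \<le> real (4 * n)" using that by simp
    then have "(f i)\<^sup>2 \<le> 4 * n" by (simp only: of_nat_le_iff)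
    moreover have "f i \<le> (f i)\<^sup>2" by (simp add: power2_eq_square)
    ultimately have "2 ^ a \<le> m" using a by (simp add: m_def)
    then have "a < m" using less_exp[of a] by linarith
    then show ?thesis using a by auto
  qed
  \<comment> \<open>The discrepancy property wants the smaller set first, so every pair of levels is
    treated in one of two orders. The 4 in \<open>?h\<close> is the loss from replacing both entries
    by their dyadic levels.\<close>
  let ?c1 = "\<lambda>a b. card (S a) \<le> card (T b) \<and> 2 ^ a \<le> 2 * w * 2 ^ b \<and> w \<le> 4 * (2 ^ a * 2 ^ b)"
  let ?c2 = "\<lambda>a b. card (T b) \<le> card (S a) \<and> 2 ^ b \<le> 2 * w * 2 ^ a \<and> w \<le> 4 * (2 ^ b * 2 ^ a)"
  let ?h = "\<lambda>a b i j. if i \<in> S a \<and> j \<in> T b \<and> (?c1 a b \<or> ?c2 a b) then 4 * A i j * 2 ^ a * 2 ^ b else 0"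
  let ?H = "\<lambda>i j. \<Sum>a<m. \<Sum>b<m. ?h a b i j"
  have pointwise: "(if w < real (u i) * real (v j) then A i j * (real (u i) * real (v j)) else 0) \<le>
      A i j * (real (u i))\<^sup>2 / w + A i j * (real (v j))\<^sup>2 / w + ?H i j"
    if i: "i \<in> W" and j: "j \<in> W" for i j
  proof -
    have Aij: "0 \<le> A i j" using A W i j by blast
    have H: "0 \<le> ?H i j" using Aij by (intro sum_nonneg) auto
    have sq: "0 \<le> A i j * (real (u i))\<^sup>2 / w" "0 \<le> A i j * (real (v j))\<^sup>2 / w"
      using Aij w by auto
    consider "\<not> w < real (u i) * real (v j)"
      | "w < real (u i) * real (v j)" "w * v j \<le> u i"
      | "w < real (u i) * real (v j)" "w * u i \<le> v j"
      | "w < real (u i) * real (v j)" "u i < w * v j" "v j < w * u i"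
      by linarith
    then show ?thesis
    proof cases
      case 1
      then show ?thesis using H sq by simp
    next
      case 2
      then have "real (u i) * (w * v j) \<le> real (u i) * u i" by (intro mult_left_mono) auto
      then have "real (u i) * real (v j) \<le> (real (u i))\<^sup>2 / w"
        using w by (simp add: pos_le_divide_eq power2_eq_square mult_ac)
      then have "A i j * (real (u i) * real (v j)) \<le> A i j * ((real (u i))\<^sup>2 / w)"
        using Aij by (rule mult_left_mono)
      then show ?thesis using 2 H sq by simp
    next
      case 3
      then have "real (v j) * (w * u i) \<le> real (v j) * v j" by (intro mult_left_mono) auto
      then have "real (u i) * real (v j) \<le> (real (v j))\<^sup>2 / w"
        using w by (simp add: pos_le_divide_eq power2_eq_square mult_ac)
      then have "A i j * (real (u i) * real (v j)) \<le> A i j * ((real (v j))\<^sup>2 / w)"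
        using Aij by (rule mult_left_mono)
      then show ?thesis using 3 H sq by simp
    next
      case 4
      have "0 < u i" "0 < v j" using 4(1) w by (auto intro!: Nat.gr0I)
      obtain a where a: "a < m" "2 ^ a \<le> u i" "u i < 2 ^ Suc a"
        using level[OF i \<open>0 < u i\<close> u] by blast
      obtain b where b: "b < m" "2 ^ b \<le> v j" "v j < 2 ^ Suc b"
        using level[OF j \<open>0 < v j\<close> v] by blast
      have a': "2 ^ a \<le> real (u i)" "real (u i) \<le> 2 * 2 ^ a"
        using a(2,3) of_nat_le_iff[of "2 ^ a" "u i", where 'a = real]
          of_nat_le_iff[of "u i" "2 * 2 ^ a", where 'a = real] by simp_all
      have b': "2 ^ b \<le> real (v j)" "real (v j) \<le> 2 * 2 ^ b"
        using b(2,3) of_nat_le_iff[of "2 ^ b" "v j", where 'a = real]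
          of_nat_le_iff[of "v j" "2 * 2 ^ b", where 'a = real] by simp_all
      have uv: "real (u i) * real (v j) \<le> (2 * 2 ^ a) * (2 * 2 ^ b)"
        using a' b' by (intro mult_mono) auto
      have "w * v j \<le> w * (2 * 2 ^ b)" "w * u i \<le> w * (2 * 2 ^ a)"
        using a' b' w by (auto intro!: mult_left_mono)
      then have "2 ^ a \<le> 2 * w * 2 ^ b" "2 ^ b \<le> 2 * w * 2 ^ a" "w \<le> 4 * (2 ^ a * 2 ^ b)"
        using 4 a' b' uv by linarith+
      then have c: "?c1 a b \<or> ?c2 a b" by (auto simp: mult.commute)
      have "A i j * (real (u i) * real (v j)) \<le> A i j * ((2 * 2 ^ a) * (2 * 2 ^ b))"
        using uv Aij by (rule mult_left_mono)
      also have "\<dots> = ?h a b i j"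
        using c a b i j by (simp add: S_def T_def)
      also have "\<dots> \<le> (\<Sum>b<m. ?h a b i j)"
        using b Aij by (intro member_le_sum[of b "{..<m}" "\<lambda>b. ?h a b i j"]) auto
      also have "\<dots> \<le> ?H i j"
        using a Aij by (intro member_le_sum[of a "{..<m}" "\<lambda>a. \<Sum>b<m. ?h a b i j"] sum_nonneg) auto
      finally show ?thesis using 4 sq by simp
    qed
  qed
  have "(\<Sum>i\<in>W. \<Sum>j\<in>W. if w < real (u i) * real (v j) then A i j * (real (u i) * real (v j)) else 0) \<le>
      (\<Sum>i\<in>W. \<Sum>j\<in>W. A i j * (real (u i))\<^sup>2 / w + A i j * (real (v j))\<^sup>2 / w + ?H i j)"
    by (intro sum_mono pointwise)
  also have "\<dots> = (\<Sum>i\<in>W. \<Sum>j\<in>W. A i j * (real (u i))\<^sup>2 / w) +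
      (\<Sum>i\<in>W. \<Sum>j\<in>W. A i j * (real (v j))\<^sup>2 / w) + (\<Sum>i\<in>W. \<Sum>j\<in>W. ?H i j)"
    by (simp only: sum.distrib)
  \<comment> \<open>320 is the degree factor 80 times the energy factor 4, once for each vector;
    122880 is 15360 for two orders, times the dyadic loss 4.\<close>
  also have "\<dots> \<le> 320 * r * n * w + 320 * r * n * w + 122880 * r * n * w"
  proof (intro add_mono)
    have deg': "(\<Sum>j\<in>W. A i j) \<le> 80 * r * d" if "i \<in> W" for i
    proof -
      have "(\<Sum>j\<in>W. A i j) \<le> (\<Sum>j\<in>{1..n}. A i j)"
        using that W by (intro sum_mono2 A) auto
      then show ?thesis using deg[OF that] by linarith
    qed
    have deg_bound: "(\<Sum>i\<in>W. \<Sum>j\<in>W. A i j * (real (f i))\<^sup>2 / w) \<le> 320 * r * n * w"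
      if f: "(\<Sum>i\<in>W. (real (f i))\<^sup>2) \<le> 4 * real n" for f :: "nat \<Rightarrow> nat"
    proof -
      have "(\<Sum>i\<in>W. \<Sum>j\<in>W. A i j * (real (f i))\<^sup>2 / w) =
          (\<Sum>i\<in>W. (\<Sum>j\<in>W. A i j) * (real (f i))\<^sup>2 / w)"
        by (simp add: sum_distrib_right sum_divide_distrib)
      also have "\<dots> \<le> (\<Sum>i\<in>W. 80 * r * d * (real (f i))\<^sup>2 / w)"
        using w by (intro sum_mono divide_right_mono mult_right_mono deg') auto
      also have "\<dots> = 80 * r * d / w * (\<Sum>i\<in>W. (real (f i))\<^sup>2)"
        by (simp add: sum_distrib_left)
      also have "\<dots> \<le> 80 * r * d / w * (4 * real n)"
        using f r d w by (intro mult_left_mono) auto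
      also have "\<dots> = 320 * r * n * w" using w by (simp add: field_simps)
      finally show ?thesis .
    qed
    show "(\<Sum>i\<in>W. \<Sum>j\<in>W. A i j * (real (u i))\<^sup>2 / w) \<le> 320 * r * n * w"
      by (rule deg_bound[OF u])
    have "(\<Sum>i\<in>W. \<Sum>j\<in>W. A i j * (real (v j))\<^sup>2 / w) =
        (\<Sum>j\<in>W. \<Sum>i\<in>W. A j i * (real (v j))\<^sup>2 / w)"
      using W by (subst sum.swap) (intro sum.cong refl, metis sym subsetD)
    also have "\<dots> \<le> 320 * r * n * w" by (rule deg_bound[OF v])
    finally show "(\<Sum>i\<in>W. \<Sum>j\<in>W. A i j * (real (v j))\<^sup>2 / w) \<le> 320 * r * n * w" .
    have "(\<Sum>i\<in>W. \<Sum>j\<in>W. ?H i j) = (\<Sum>a<m. \<Sum>b<m. \<Sum>i\<in>W. \<Sum>j\<in>W. ?h a b i j)"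
    proof -
      have "(\<Sum>i\<in>W. \<Sum>j\<in>W. ?H i j) = (\<Sum>i\<in>W. \<Sum>a<m. \<Sum>j\<in>W. \<Sum>b<m. ?h a b i j)"
        by (intro sum.cong refl sum.swap)
      also have "\<dots> = (\<Sum>a<m. \<Sum>i\<in>W. \<Sum>j\<in>W. \<Sum>b<m. ?h a b i j)" by (rule sum.swap)
      also have "\<dots> = (\<Sum>a<m. \<Sum>i\<in>W. \<Sum>b<m. \<Sum>j\<in>W. ?h a b i j)"
        by (intro sum.cong refl sum.swap)
      also have "\<dots> = (\<Sum>a<m. \<Sum>b<m. \<Sum>i\<in>W. \<Sum>j\<in>W. ?h a b i j)"
        by (intro sum.cong refl sum.swap)
      finally show ?thesis .
    qed
    also have "\<dots> \<le> (\<Sum>a<m. \<Sum>b<m.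
        4 * (if ?c1 a b then edge_count A (S a) (T b) * 2 ^ a * 2 ^ b else 0) +
        4 * (if ?c2 a b then edge_count A (T b) (S a) * 2 ^ b * 2 ^ a else 0))"
    proof (intro sum_mono)
      fix a b
      have fin: "finite (S a)" "finite (T b)" using finW by (auto simp: S_def T_def)
      have ec: "edge_count A (T b) (S a) = edge_count A (S a) (T b)"
        unfolding edge_count_def using ST by (subst sum.swap) (intro sum.cong refl, metis sym subsetD)
      have ec0: "0 \<le> edge_count A (S a) (T b)"
        unfolding edge_count_def using ST by (intro sum_nonneg A) blast+
      have "(\<Sum>i\<in>W. \<Sum>j\<in>W. if i \<in> S a \<and> j \<in> T b then 4 * A i j * 2 ^ a * 2 ^ b else 0) =
          (\<Sum>i\<in>S a. \<Sum>j\<in>T b. 4 * A i j * 2 ^ a * 2 ^ b)"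
      proof -
        have "(\<Sum>i\<in>S a. \<Sum>j\<in>T b. 4 * A i j * 2 ^ a * 2 ^ b) =
            (\<Sum>i\<in>W. if i \<in> S a then \<Sum>j\<in>W. if j \<in> T b then 4 * A i j * 2 ^ a * 2 ^ b else 0 else 0)"
          using finW by (simp add: S_def T_def flip: sum.inter_filter)
        also have "\<dots> = (\<Sum>i\<in>W. \<Sum>j\<in>W. if i \<in> S a \<and> j \<in> T b then 4 * A i j * 2 ^ a * 2 ^ b else 0)"
          by (intro sum.cong refl) auto
        finally show ?thesis by simp
      qed
      also have "\<dots> = 4 * (edge_count A (S a) (T b) * 2 ^ a * 2 ^ b)"
        by (simp add: edge_count_def sum_distrib_left sum_distrib_right mult_ac)
      finally have "(\<Sum>i\<in>W. \<Sum>j\<in>W. if i \<in> S a \<and> j \<in> T b \<and> c then 4 * A i j * 2 ^ a * 2 ^ b else 0) =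
          (if c then 4 * (edge_count A (S a) (T b) * 2 ^ a * 2 ^ b) else 0)" for c
        by (cases c) simp_all
      then have "(\<Sum>i\<in>W. \<Sum>j\<in>W. ?h a b i j) =
          (if ?c1 a b \<or> ?c2 a b then 4 * (edge_count A (S a) (T b) * 2 ^ a * 2 ^ b) else 0)" .
      also have "\<dots> \<le> 4 * (if ?c1 a b then edge_count A (S a) (T b) * 2 ^ a * 2 ^ b else 0) +
          4 * (if ?c2 a b then edge_count A (T b) (S a) * 2 ^ b * 2 ^ a else 0)"
      proof -
        have swap: "edge_count A (T b) (S a) * 2 ^ b * 2 ^ a = edge_count A (S a) (T b) * 2 ^ a * 2 ^ b"
          by (simp add: ec)
        have "(if c \<or> c' then 4 * E else 0) \<le> 4 * (if c then E else 0) + 4 * (if c' then E else 0)"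
          if "0 \<le> E" for c c' and E :: real
          using that by simp
        moreover have "0 \<le> edge_count A (S a) (T b) * 2 ^ a * 2 ^ b" using ec0 by simp
        ultimately show ?thesis unfolding swap by blast
      qed
      finally show "(\<Sum>i\<in>W. \<Sum>j\<in>W. ?h a b i j) \<le>
          4 * (if ?c1 a b then edge_count A (S a) (T b) * 2 ^ a * 2 ^ b else 0) +
          4 * (if ?c2 a b then edge_count A (T b) (S a) * 2 ^ b * 2 ^ a else 0)" .
    qed
    also have "\<dots> = 4 * (\<Sum>a<m. \<Sum>b<m. if ?c1 a b then edge_count A (S a) (T b) * 2 ^ a * 2 ^ b else 0) +
        4 * (\<Sum>b<m. \<Sum>a<m. if ?c2 a b then edge_count A (T b) (S a) * 2 ^ b * 2 ^ a else 0)"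
      by (subst (3) sum.swap) (simp only: sum.distrib sum_distrib_left)
    also have "\<dots> \<le> 4 * (15360 * r * n * w) + 4 * (15360 * r * n * w)"
      unfolding w_def
      by (intro add_mono mult_left_mono heavy_dyadic_le[OF n d r disc A] ST S4 T4) auto
    also have "4 * (15360 * r * n * w) + 4 * (15360 * r * n * w) = 122880 * r * n * w" by simp
    finally show "(\<Sum>i\<in>W. \<Sum>j\<in>W. ?H i j) \<le> 122880 * r * n * w" .
  qed
  finally show ?thesis by (simp add: w_def)
qed

section \<open>High-degree vertices and sparsity\<close>

text \<open>For \<open>d < 2\<close> the sparsity below holds for all vertex sets, so every vertex may go into \<open>H\<close>.\<close>

lemma high_degree_set:
  fixes d r :: real
  assumes n: "1 \<le> n" and d: "0 < d" and r: "1 \<le> r" and deg: "degree_sum_bound n d r A"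
  shows "\<exists>H \<subseteq> {1..n}. (\<forall>i\<in>{1..n} - H. (\<Sum>j\<in>{1..n}. A i j) \<le> 80 * r * d) \<and>
    (\<forall>U \<subseteq> {1..n}. card U \<le> 2 * card H \<longrightarrow> card U * d\<^sup>2 \<le> 4 * n) \<and> card H * d \<le> 2 * n"
proof (cases "d < 2")
  case True
  have "card U * d\<^sup>2 \<le> 4 * n" if "U \<subseteq> {1..n}" for U
  proof -
    have "card U \<le> n" using card_mono[OF _ that] by simp
    moreover have "d\<^sup>2 \<le> 2\<^sup>2" using True d by (intro power_mono) auto
    ultimately have "real (card U) * d\<^sup>2 \<le> real n * 2\<^sup>2" by (intro mult_mono) auto
    then show ?thesis by simp
  qed
  moreover have "real n * d \<le> real n * 2" using True by (intro mult_left_mono) auto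
  ultimately show ?thesis by (intro exI[of _ "{1..n}"] conjI) (simp_all add: mult.commute)
next
  case False
  define H where "H = {i\<in>{1..n}. 80 * r * d < (\<Sum>j\<in>{1..n}. A i j)}"
  define h where "h = real (card H)"
  have H: "H \<subseteq> {1..n}" "finite H" by (auto simp: H_def)
  have h: "2 * h * d\<^sup>2 \<le> n"
  proof (cases "H = {}")
    case False
    then have h: "1 \<le> h" using H by (simp add: h_def Suc_le_eq card_gt_0_iff)
    have "80 * r * d * h = (\<Sum>i\<in>H. 80 * r * d)" by (simp add: h_def)
    also have "\<dots> \<le> edge_count A H {1..n}"
      unfolding edge_count_def by (intro sum_mono) (auto simp: H_def)
    also have "\<dots> \<le> 20 * r * (d * h + subset_entropy n h)"
      using deg H False unfolding degree_sum_bound_def h_def by blast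
    \<comment> \<open>The gap between the factors 80 and 20 leaves
      \<open>3 d <= 1 + ln (n / h)\<close>, so \<open>n / h\<close> is exponentially large in
      \<open>d\<close> and beats \<open>2 d^2\<close> once \<open>d >= 2\<close>.\<close>
    finally have "(20 * r) * (4 * d * h) \<le> (20 * r) * (d * h + subset_entropy n h)"
      by (simp add: mult_ac)
    then have "4 * d * h \<le> d * h + subset_entropy n h"
      using r by (subst (asm) mult_le_cancel_left_pos) auto
    then have "h * (3 * d) \<le> h * (1 + ln (n / h))"
      by (simp add: subset_entropy_def algebra_simps)
    then have "3 * d \<le> 1 + ln (n / h)" using h by (subst (asm) mult_le_cancel_left_pos) auto
    then have "exp (3 * d - 1) \<le> n / h"
      using h n by (subst ln_ge_iff[symmetric]) auto
    moreover have "d\<^sup>2 * 2 \<le> exp (3 * d - 1)"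
    proof -
      have e: "d \<le> exp d" "2 \<le> exp (d - 1)"
        using exp_ge_add_one_self[of d] exp_ge_add_one_self[of "d - 1"] \<open>\<not> d < 2\<close> by linarith+
      have "d * d * 2 \<le> exp d * exp d * exp (d - 1)" using e d by (intro mult_mono) auto
      then show ?thesis by (simp add: power2_eq_square flip: exp_add)
    qed
    ultimately have "d\<^sup>2 * 2 \<le> n / h" by linarith
    then show ?thesis using h by (simp add: field_simps)
  qed (simp add: h_def)
  have "card U * d\<^sup>2 \<le> 4 * n" if "card U \<le> 2 * card H" for U :: "nat set"
  proof -
    have "real (card U) \<le> 2 * h" using that by (simp add: h_def)
    then have "real (card U) * d\<^sup>2 \<le> 2 * h * d\<^sup>2" by (intro mult_right_mono) auto
    then show ?thesis using h by linarith
  qed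
  moreover have "h * d \<le> 2 * n"
  proof -
    have "1 * d \<le> d * d" using False d by (intro mult_right_mono) auto
    then have "h * d \<le> h * d\<^sup>2"
      by (intro mult_left_mono) (auto simp: h_def power2_eq_square)
    then show ?thesis using h by linarith
  qed
  moreover have "\<forall>i\<in>{1..n} - H. (\<Sum>j\<in>{1..n}. A i j) \<le> 80 * r * d"
    by (simp add: H_def not_less)
  ultimately show ?thesis using H(1) unfolding h_def by (intro exI[of _ H] conjI allI impI) simp_all
qed

text \<open>Smallness gives \<open>\<mu> <= 2 s sqrt (s / n)\<close>. If \<open>e > 80 r s\<close>,
  then \<open>(e / \<mu>)^2 >= 1600 n / s\<close>, so \<open>2 ln (e / \<mu>)\<close> dominates
  \<open>1 + ln (n / s)\<close>; cancelling this factor in the entropy bound contradicts the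
  assumption.\<close>

lemma discrepancy_imp_sparse:
  fixes d r :: real
  assumes n: "1 \<le> n" and d: "0 < d" and r: "1 \<le> r" and disc: "discrepancy_bound n d r A"
    and U: "U \<subseteq> {1..n}" "U \<noteq> {}" and small: "card U * d\<^sup>2 \<le> 4 * n"
  shows "edge_count A U U \<le> 80 * r * card U"
proof (rule ccontr)
  define s where "s = real (card U)"
  define e where "e = edge_count A U U"
  define \<mu> where "\<mu> = d * s * s / n"
  assume "\<not> ?thesis"
  then have e: "80 * r * s < e" by (simp add: e_def s_def)
  have "finite U" using U finite_subset by blast
  then have s: "1 \<le> s" "s \<le> n"
    using U card_mono[of "{1..n}" U] by (auto simp: s_def Suc_le_eq card_gt_0_iff)
  have small': "s * d\<^sup>2 \<le> 4 * n" using small by (simp add: s_def)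
  have n0: "0 < real n" using n by simp
  have s0: "0 < s" using s by linarith
  have rs: "1 * s \<le> r * s" using r s by (intro mult_right_mono) auto
  have e0: "80 * s < e" using e rs by linarith
  have \<mu>_pos: "0 < \<mu>" using d s0 n0 by (simp add: \<mu>_def)
  have \<mu>2: "\<mu>\<^sup>2 \<le> 4 * s\<^sup>2 * (s / n)"
  proof -
    have "\<mu>\<^sup>2 = (s * d\<^sup>2) * (s\<^sup>2 * s / n\<^sup>2)"
      by (simp add: \<mu>_def power2_eq_square)
    also have "\<dots> \<le> (4 * n) * (s\<^sup>2 * s / n\<^sup>2)"
      using small' s0 by (intro mult_right_mono) auto
    also have "\<dots> = 4 * s\<^sup>2 * (s / n)" using n0 by (simp add: power2_eq_square)
    finally show ?thesis .
  qed
  have "\<mu>\<^sup>2 \<le> (2 * s)\<^sup>2"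
  proof -
    have "s / n \<le> 1" using s n0 by simp
    then have "4 * s\<^sup>2 * (s / n) \<le> 4 * s\<^sup>2 * 1" by (intro mult_left_mono) auto
    then show ?thesis using \<mu>2 by (simp add: power_mult_distrib)
  qed
  then have "\<mu> \<le> 2 * s" by (rule power2_le_imp_le) (use s0 in auto)
  then have "\<not> e \<le> 9 * \<mu>" using e0 s0 by linarith
  then have *: "e * ln (e / \<mu>) \<le> 40 * r * subset_entropy n s"
    using disc U unfolding discrepancy_bound_def Let_def e_def \<mu>_def s_def by blast
  have "exp 1 * (n / s) \<le> (e / \<mu>)\<^sup>2"
  proof -
    have "exp 1 * (n / s) \<le> 1600 * (n / s)"
      using exp_le n0 s0 by (intro mult_right_mono) auto
    also have "\<dots> = (80 * s)\<^sup>2 / (4 * s\<^sup>2 * (s / n))"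
      using n0 s0 by (simp add: power2_eq_square)
    also have "\<dots> \<le> e\<^sup>2 / \<mu>\<^sup>2"
      using e0 s0 \<mu>2 \<mu>_pos by (intro frac_le power_mono) auto
    finally show ?thesis by (simp add: power_divide)
  qed
  then have "ln (exp 1 * (n / s)) \<le> ln ((e / \<mu>)\<^sup>2)"
    using n0 s0 by (intro ln_mono) auto
  moreover have "ln (exp 1 * (n / s)) = 1 + ln (n / s)"
    using n0 s0 by (subst ln_mult) auto
  moreover have "ln ((e / \<mu>)\<^sup>2) = 2 * ln (e / \<mu>)"
    using e0 s0 \<mu>_pos by (subst ln_realpow) auto
  ultimately have L: "1 + ln (n / s) \<le> 2 * ln (e / \<mu>)" by simp
  have L0: "1 \<le> 1 + ln (n / s)" using n0 s0 s by simp
  have "e * (1 + ln (n / s)) \<le> e * (2 * ln (e / \<mu>))"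
    using L e0 s0 by (intro mult_left_mono) auto
  also have "\<dots> = 2 * (e * ln (e / \<mu>))" by simp
  also have "\<dots> \<le> 2 * (40 * r * (s * (1 + ln (n / s))))"
    using * unfolding subset_entropy_def by (intro mult_left_mono) auto
  also have "\<dots> = 80 * r * s * (1 + ln (n / s))" by simp
  finally have "e \<le> 80 * r * s"
    using L0 by (subst (asm) mult_le_cancel_right_pos) auto
  then show False using e by linarith
qed

section \<open>The bilinear form\<close>

text \<open>Bounding every \<open>p i j\<close> by \<open>d / n\<close> makes the form a product of
  two sums, each estimated by Cauchy--Schwarz; the support in \<open>S\<close> gains
  \<open>sqrt (card S / n)\<close>. Applied with \<open>c = 2\<close> to \<open>H\<close> and
  \<open>c = 10\<close> to \<open>V0\<close>.\<close>

lemma mean_sum_le: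
  fixes d c :: real and x y :: "nat \<Rightarrow> real"
  assumes n: "1 \<le> n" and d: "0 \<le> d"
    and p: "\<And>i j. i \<in> {1..n} \<Longrightarrow> j \<in> {1..n} \<Longrightarrow> p i j \<le> d / n"
    and S: "S \<subseteq> {1..n}" "card S * d \<le> c * n"
    and x: "\<And>i. 0 \<le> x i" "(\<Sum>i\<in>{1..n}. (x i)\<^sup>2) \<le> 4 * real n"
    and y: "\<And>i. 0 \<le> y i" "(\<Sum>i\<in>{1..n}. (y i)\<^sup>2) \<le> 4 * real n"
  shows "(\<Sum>i\<in>S. \<Sum>j\<in>{1..n}. p i j * (x i * y j)) \<le> 4 * sqrt c * n * sqrt d"
proof -
  have n0: "0 < real n" using n by simp
  have "(\<Sum>i\<in>S. \<Sum>j\<in>{1..n}. p i j * (x i * y j)) \<le> (\<Sum>i\<in>S. \<Sum>j\<in>{1..n}. d / n * (x i * y j))"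
    using S x y by (intro sum_mono mult_right_mono p) auto
  also have "\<dots> = d / n * ((\<Sum>i\<in>S. x i) * (\<Sum>j\<in>{1..n}. y j))"
    by (subst sum_product) (simp add: sum_distrib_left)
  also have "\<dots> \<le> d / n * (sqrt (card S * (4 * real n)) * (2 * real n))"
  proof (intro mult_left_mono mult_mono)
    have "(\<Sum>i\<in>S. x i)\<^sup>2 \<le> (\<Sum>i\<in>S. (x i)\<^sup>2) * card S"
      by (rule sum_squared_le_sum_of_squares)
    also have "(\<Sum>i\<in>S. (x i)\<^sup>2) \<le> (\<Sum>i\<in>{1..n}. (x i)\<^sup>2)"
      using S by (intro sum_mono2) auto
    finally have "(\<Sum>i\<in>S. x i)\<^sup>2 \<le> 4 * real n * card S"
      using x(2) by (meson mult_right_mono of_nat_0_le_iff order_trans)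
    then show "(\<Sum>i\<in>S. x i) \<le> sqrt (card S * (4 * real n))"
      by (intro real_le_rsqrt) (simp add: mult_ac)
    have "(\<Sum>j\<in>{1..n}. y j)\<^sup>2 \<le> (\<Sum>j\<in>{1..n}. (y j)\<^sup>2) * card {1..n}"
      by (rule sum_squared_le_sum_of_squares)
    also have "\<dots> \<le> 4 * real n * card {1..n}" using y(2) by (intro mult_right_mono) auto
    also have "\<dots> = (2 * real n)\<^sup>2" by (simp add: power2_eq_square)
    finally show "(\<Sum>j\<in>{1..n}. y j) \<le> 2 * real n" by (rule power2_le_imp_le) simp
  qed (use d x y in \<open>auto intro: sum_nonneg\<close>)
  also have "sqrt (card S * (4 * real n)) = 2 * sqrt (real n * real (card S))"
    by (simp add: real_sqrt_mult)
  also have "d / n * (2 * sqrt (real n * real (card S)) * (2 * real n)) = 4 * (d * sqrt (real n * real (card S)))"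
    using n0 by simp
  also have "d * sqrt (real n * real (card S)) = (sqrt d * sqrt d) * sqrt (real n * real (card S))"
    using d by simp
  also have "\<dots> = sqrt d * sqrt (real n * (real (card S) * d))"
    by (simp only: real_sqrt_mult mult_ac)
  also have "4 * \<dots> \<le> 4 * (sqrt d * sqrt (n * (c * n)))"
    using S(2) d by (intro mult_left_mono real_sqrt_le_mono) auto
  also have "sqrt (n * (c * n)) = sqrt (real n * real n) * sqrt c"
    by (simp only: real_sqrt_mult mult_ac)
  also have "4 * (sqrt d * (sqrt (real n * real n) * sqrt c)) = 4 * sqrt c * n * sqrt d"
    by simp
  finally show ?thesis .
qed

text \<open>Rounding each coordinate in the direction favoured by the linear form loses nothing, so no
  approximation error arises in passing from the unit ball to the lattice.\<close>

lemma round_to_lattice: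
  fixes Y c :: "nat \<Rightarrow> real"
  assumes "(\<Sum>i\<in>{1..n}. (Y i)\<^sup>2) \<le> n"
  shows "\<exists>k\<in>lattice_ball n. (\<Sum>i\<in>{1..n}. Y i * c i) \<le> (\<Sum>i\<in>{1..n}. real_of_int (k i) * c i)"
proof -
  define k where "k i = (if 0 \<le> c i then \<lceil>Y i\<rceil> else \<lfloor>Y i\<rfloor>)" for i
  have "(real_of_int (k i))\<^sup>2 \<le> 2 * (Y i)\<^sup>2 + 2" for i
  proof -
    have "\<bar>real_of_int (k i)\<bar> \<le> \<bar>Y i\<bar> + 1" unfolding k_def by (split if_split) linarith
    then have "\<bar>real_of_int (k i)\<bar>\<^sup>2 \<le> (\<bar>Y i\<bar> + 1)\<^sup>2" by (intro power_mono) auto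
    also have "\<dots> \<le> 2 * (Y i)\<^sup>2 + 2"
      using zero_le_power2[of "\<bar>Y i\<bar> - 1"] by (simp add: power2_sum power2_diff)
    finally show ?thesis by simp
  qed
  then have "(\<Sum>i\<in>{1..n}. (real_of_int (k i))\<^sup>2) \<le> (\<Sum>i\<in>{1..n}. 2 * (Y i)\<^sup>2 + 2)"
    by (intro sum_mono)
  also have "\<dots> \<le> 4 * n" using assms by (simp add: sum.distrib flip: sum_distrib_left)
  finally have "restrict k {1..n} \<in> lattice_ball n" by (simp add: lattice_ball_def)
  moreover have "(\<Sum>i\<in>{1..n}. Y i * c i) \<le> (\<Sum>i\<in>{1..n}. real_of_int (restrict k {1..n} i) * c i)"
  proof (rule sum_mono)
    fix i assume "i \<in> {1..n}"
    moreover have "Y i * c i \<le> real_of_int (k i) * c i"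
      unfolding k_def by (auto intro: mult_right_mono mult_right_mono_neg)
    ultimately show "Y i * c i \<le> real_of_int (restrict k {1..n} i) * c i" by simp
  qed
  ultimately show ?thesis by blast
qed

text \<open>\<open>M x\<close> is paired with its own direction, and both vectors are scaled by
  \<open>sqrt n\<close>, hence the factor \<open>n\<close>. They are rounded in turn, the second
  against the linear form that already contains the rounded first.\<close>

lemma spectral_norm_le_lattice:
  fixes B :: real
  assumes n: "1 \<le> n"
    and M: "\<And>k l. k \<in> lattice_ball n \<Longrightarrow> l \<in> lattice_ball n \<Longrightarrow>
      (\<Sum>i\<in>{1..n}. \<Sum>j\<in>{1..n}. M i j * (real_of_int (k i) * real_of_int (l j))) \<le> n * B"
  shows "spectral_norm n M \<le> B"
  unfolding spectral_norm_def
proof (rule cSUP_least)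
  show "{x. L2_set x {1..n} \<le> 1} \<noteq> {}"
    by (auto simp: L2_set_def intro!: exI[of _ "\<lambda>_. 0"])
  fix x assume "x \<in> {x. L2_set x {1..n} \<le> 1}"
  then have x: "(\<Sum>i\<in>{1..n}. (x i)\<^sup>2) \<le> 1" by (simp add: L2_set_def)
  define v where "v i = (\<Sum>j\<in>{1..n}. M i j * x j)" for i
  define N where "N = L2_set v {1..n}"
  have n0: "0 < real n" using n by simp
  \<comment> \<open>The zero vector yields \<open>B >= 0\<close>, needed when the image of
    \<open>x\<close> vanishes.\<close>
  have "(\<lambda>i\<in>{1..n}. 0) \<in> lattice_ball n" by (simp add: lattice_ball_def)
  from M[OF this this] have "0 \<le> n * B" by simp
  then have B: "0 \<le> B" using n0 by (simp add: zero_le_mult_iff)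
  have "N \<le> B"
  proof (cases "N = 0")
    case False
    have N: "0 < N" using False L2_set_nonneg[of v "{1..n}"] unfolding N_def by linarith
    have N2: "N\<^sup>2 = (\<Sum>i\<in>{1..n}. (v i)\<^sup>2)" by (simp add: N_def L2_set_def sum_nonneg)
    define Y where "Y i = sqrt n * (v i / N)" for i
    define X where "X j = sqrt n * x j" for j
    have Y2: "(\<Sum>i\<in>{1..n}. (Y i)\<^sup>2) \<le> n"
    proof -
      have "(\<Sum>i\<in>{1..n}. (Y i)\<^sup>2) = n / N\<^sup>2 * (\<Sum>i\<in>{1..n}. (v i)\<^sup>2)"
        by (simp add: Y_def power_mult_distrib power_divide sum_distrib_left)
      also have "\<dots> = n" unfolding N2[symmetric] using N by simp
      finally show ?thesis by simp
    qed
    have X2: "(\<Sum>i\<in>{1..n}. (X i)\<^sup>2) \<le> n"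
      using x n0 by (simp add: X_def power_mult_distrib mult_left_le flip: sum_distrib_left)
    obtain k where k: "k \<in> lattice_ball n"
      "(\<Sum>i\<in>{1..n}. Y i * (\<Sum>j\<in>{1..n}. M i j * X j)) \<le>
       (\<Sum>i\<in>{1..n}. real_of_int (k i) * (\<Sum>j\<in>{1..n}. M i j * X j))"
      using round_to_lattice[OF Y2, of "\<lambda>i. \<Sum>j\<in>{1..n}. M i j * X j"] by blast
    obtain l where l: "l \<in> lattice_ball n"
      "(\<Sum>j\<in>{1..n}. X j * (\<Sum>i\<in>{1..n}. M i j * real_of_int (k i))) \<le>
       (\<Sum>j\<in>{1..n}. real_of_int (l j) * (\<Sum>i\<in>{1..n}. M i j * real_of_int (k i)))"
      using round_to_lattice[OF X2, of "\<lambda>j. \<Sum>i\<in>{1..n}. M i j * real_of_int (k i)"] by blast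
    have MX: "(\<Sum>j\<in>{1..n}. M i j * X j) = sqrt n * v i" for i
      by (simp add: X_def v_def sum_distrib_left mult_ac)
    have "n * N = (\<Sum>i\<in>{1..n}. Y i * (\<Sum>j\<in>{1..n}. M i j * X j))"
    proof -
      have "(\<Sum>i\<in>{1..n}. Y i * (\<Sum>j\<in>{1..n}. M i j * X j)) = (\<Sum>i\<in>{1..n}. n / N * (v i)\<^sup>2)"
        unfolding MX Y_def by (intro sum.cong) (auto simp: power2_eq_square)
      also have "\<dots> = n / N * N\<^sup>2" by (simp only: N2 sum_distrib_left)
      also have "\<dots> = n * N" using N by (simp add: power2_eq_square)
      finally show ?thesis by simp
    qed
    also have "\<dots> \<le> (\<Sum>i\<in>{1..n}. real_of_int (k i) * (\<Sum>j\<in>{1..n}. M i j * X j))" by (rule k(2))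
    also have "\<dots> = (\<Sum>j\<in>{1..n}. X j * (\<Sum>i\<in>{1..n}. M i j * real_of_int (k i)))"
      unfolding sum_distrib_left by (subst sum.swap) (simp add: mult_ac)
    also have "\<dots> \<le> (\<Sum>j\<in>{1..n}. real_of_int (l j) * (\<Sum>i\<in>{1..n}. M i j * real_of_int (k i)))"
      by (rule l(2))
    also have "\<dots> = (\<Sum>i\<in>{1..n}. \<Sum>j\<in>{1..n}. M i j * (real_of_int (k i) * real_of_int (l j)))"
      unfolding sum_distrib_left by (subst sum.swap) (simp add: mult_ac)
    also have "\<dots> \<le> n * B" by (rule M[OF k(1) l(1)])
    finally show ?thesis using n0 by (subst (asm) mult_le_cancel_left_pos)
  qed (use B in simp)
  then show "L2_set (\<lambda>i. \<Sum>j\<in>{1..n}. M i j * x j) {1..n} \<le> B"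
    by (simp add: N_def v_def[abs_def])
qed

text \<open>Covers both zeroing coordinates and replacing them by absolute values.\<close>

lemma lattice_ball_restrict:
  assumes "k \<in> lattice_ball n" "\<And>i. i \<in> {1..n} \<Longrightarrow> \<bar>f i\<bar> \<le> \<bar>k i\<bar>"
  shows "restrict f {1..n} \<in> lattice_ball n"
proof -
  have "(real_of_int (f i))\<^sup>2 \<le> (real_of_int (k i))\<^sup>2" if "i \<in> {1..n}" for i
    using assms(2)[OF that] by (simp flip: abs_le_square_iff)
  then have "(\<Sum>i\<in>{1..n}. (real_of_int (f i))\<^sup>2) \<le> (\<Sum>i\<in>{1..n}. (real_of_int (k i))\<^sup>2)"
    by (intro sum_mono)
  then show ?thesis using assms(1) by (simp add: lattice_ball_def)
qed

lemma sum_if_subset: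
  fixes f :: "nat \<Rightarrow> nat \<Rightarrow> real"
  assumes "S \<subseteq> {1..n}"
  shows "(\<Sum>i\<in>{1..n}. \<Sum>j\<in>{1..n}. if i \<in> S then f i j else 0) = (\<Sum>i\<in>S. \<Sum>j\<in>{1..n}. f i j)"
proof -
  have "(\<Sum>i\<in>{1..n}. \<Sum>j\<in>{1..n}. if i \<in> S then f i j else 0) =
      (\<Sum>i\<in>{1..n}. if i \<in> S then \<Sum>j\<in>{1..n}. f i j else 0)"
    by (intro sum.cong) auto
  also have "\<dots> = (\<Sum>i\<in>{1..n} \<inter> S. \<Sum>j\<in>{1..n}. f i j)"
    by (rule sum.inter_restrict[symmetric]) simp
  also have "{1..n} \<inter> S = S" using assms by auto
  finally show ?thesis .
qed

text \<open>Purely deterministic: randomness enters only through \<open>disc\<close>,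
  \<open>deg\<close> and \<open>light\<close>, so \<open>V0\<close> and \<open>A'\<close> may depend
  on \<open>A\<close>.\<close>

lemma bilinear_le:
  fixes d r D :: real and p A A' :: "nat \<Rightarrow> nat \<Rightarrow> real"
  assumes n: "1 \<le> n" and d: "0 < d" and r: "1 \<le> r"
    and p: "\<And>i j. i \<in> {1..n} \<Longrightarrow> j \<in> {1..n} \<Longrightarrow> 0 \<le> p i j"
      "\<And>i j. i \<in> {1..n} \<Longrightarrow> j \<in> {1..n} \<Longrightarrow> p i j \<le> d / n"
    and A: "\<And>i j. i \<in> {1..n} \<Longrightarrow> j \<in> {1..n} \<Longrightarrow> A i j \<in> {0, 1}"
    and sym: "\<And>i j. i \<in> {1..n} \<Longrightarrow> j \<in> {1..n} \<Longrightarrow> A i j = A j i"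
    and disc: "discrepancy_bound n d r A" and deg: "degree_sum_bound n d r A"
    and light: "light_bound n d r p A"
    and V0: "V0 \<subseteq> {1..n}" "card V0 * d \<le> 10 * n"
    and rw: "reweighting n V0 A A'"
    and D: "\<And>i. i \<in> {1..n} \<Longrightarrow> (\<Sum>j\<in>{1..n}. (A' i j)\<^sup>2) \<le> D"
    and k: "k \<in> lattice_ball n" and l: "l \<in> lattice_ball n"
  shows "(\<Sum>i\<in>{1..n}. \<Sum>j\<in>{1..n}. (A' i j - p i j) * (real_of_int (k i) * real_of_int (l j)))
    \<le> n * (123814 * r * sqrt d + 104 * r * sqrt D)"
proof -
  define w where "w = sqrt d"
  have w: "0 < w" "w * w = d" using d by (auto simp: w_def)
  define u where "u i = real_of_int \<bar>k i\<bar>" for i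
  define v where "v i = real_of_int \<bar>l i\<bar>" for i
  have uv: "0 \<le> u i" "0 \<le> v i" for i by (auto simp: u_def v_def)
  have u2: "(\<Sum>i\<in>{1..n}. (u i)\<^sup>2) \<le> 4 * real n" and v2: "(\<Sum>i\<in>{1..n}. (v i)\<^sup>2) \<le> 4 * real n"
    using k l by (auto simp: lattice_ball_def u_def v_def)
  have n0: "0 < real n" using n by simp
  have A0: "0 \<le> A i j" if "i \<in> {1..n}" "j \<in> {1..n}" for i j using A[OF that] by auto
  have A': "A' i j = A' j i" "0 \<le> A' i j" "A' i j \<le> A i j"
      "i \<notin> V0 \<Longrightarrow> j \<notin> V0 \<Longrightarrow> A' i j = A i j"
    if "i \<in> {1..n}" "j \<in> {1..n}" for i j
    using rw that unfolding reweighting_def by blast+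
  obtain H where H: "H \<subseteq> {1..n}" "\<And>i. i \<in> {1..n} - H \<Longrightarrow> (\<Sum>j\<in>{1..n}. A i j) \<le> 80 * r * d"
      "\<And>U. U \<subseteq> {1..n} \<Longrightarrow> card U \<le> 2 * card H \<Longrightarrow> card U * d\<^sup>2 \<le> 4 * n"
      "card H * d \<le> 2 * n"
    using high_degree_set[OF n d r deg] by (elim exE conjE) (rule that, assumption, simp_all)
  have "\<exists>Q. (\<forall>i\<in>{1..n}. (\<Sum>j\<in>{1..n}. if (i, j) \<in> Q then A i j else 0) \<le> 2 * (80 * r)) \<and>
      (\<forall>i\<in>H. \<forall>j\<in>{1..n}. (i, j) \<in> Q \<or> (j, i) \<in> Q)"
  proof (rule orientation_incident[OF _ H(1) _ A0])
    fix U assume "U \<subseteq> {1..n}" "U \<noteq> {}" "card U \<le> 2 * card H"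
    then show "edge_count A U U \<le> 80 * r * card U"
      using H(3)[of U] by (intro discrepancy_imp_sparse[OF n d r disc]) simp_all
  qed (use r in auto)
  then obtain Q where Q: "\<forall>i\<in>{1..n}. (\<Sum>j\<in>{1..n}. if (i, j) \<in> Q then A i j else 0) \<le> 2 * (80 * r)"
      "\<forall>i\<in>H. \<forall>j\<in>{1..n}. (i, j) \<in> Q \<or> (j, i) \<in> Q"
    by (elim exE conjE) (rule that)
  have Q1: "(\<Sum>j\<in>{1..n}. if (i, j) \<in> Q then A i j else 0) \<le> 160 * r" if "i \<in> {1..n}" for i
    using bspec[OF Q(1) that] by simp
  define c where "c k l i j = (if \<bar>real_of_int (k i) * real_of_int (l j)\<bar> \<le> w
      then real_of_int (k i) * real_of_int (l j) else 0)" for k l :: "nat \<Rightarrow> int" and i j :: nat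
  have lightD: "(\<Sum>i\<in>{1..n}. \<Sum>j\<in>{1..n}. c k l i j * (A i j - p i j)) \<le> 80 * r * n * w"
    if "k \<in> lattice_ball n" "l \<in> lattice_ball n" for k l
    using light that unfolding light_bound_def c_def w_def by blast
  \<comment> \<open>Signs are kept in \<open>k1\<close> and \<open>l1\<close>, where the true
    centred form is bounded. The reweighting error has unknown sign, so the other vectors are
    absolute values: \<open>k2\<close> selects the rows in \<open>V0\<close>, \<open>l3\<close> the
    columns.\<close>
  define k1 where "k1 = restrict (\<lambda>i. if i \<in> H then 0 else k i) {1..n}"
  define l1 where "l1 = restrict (\<lambda>i. if i \<in> H then 0 else l i) {1..n}"
  define k2 where "k2 = restrict (\<lambda>i. if i \<in> V0 then \<bar>k i\<bar> else 0) {1..n}"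
  define l2 where "l2 = restrict (\<lambda>i. \<bar>l i\<bar>) {1..n}"
  define k3 where "k3 = restrict (\<lambda>i. \<bar>k i\<bar>) {1..n}"
  define l3 where "l3 = restrict (\<lambda>i. if i \<in> V0 then \<bar>l i\<bar> else 0) {1..n}"
  have balls: "k1 \<in> lattice_ball n" "l1 \<in> lattice_ball n" "k2 \<in> lattice_ball n"
      "l2 \<in> lattice_ball n" "k3 \<in> lattice_ball n" "l3 \<in> lattice_ball n"
    unfolding k1_def l1_def k2_def l2_def k3_def l3_def
    by (rule lattice_ball_restrict[OF k] lattice_ball_restrict[OF l], simp)+
  text \<open>\<open>?O\<close>, \<open>?P H\<close>: pairs meeting \<open>H\<close>.  \<open>?L1\<close>: light pairs outside \<open>H\<close> with the original weights.
    \<open>?L2 + ?P V0\<close>: the reweighting error of light pairs, at most \<open>A i j * u i * v j\<close> for \<open>i \<in> V0\<close>.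
    \<open>?h\<close>, \<open>?h'\<close>: heavy pairs.  Primes mark the transposed terms.\<close>
  let ?O = "\<lambda>i j. if (i, j) \<in> Q then A' i j * u i * v j else 0"
  let ?O' = "\<lambda>i j. if (j, i) \<in> Q then A' i j * u i * v j else 0"
  let ?P = "\<lambda>S i j. if i \<in> S then p i j * (u i * v j) else 0"
  let ?P' = "\<lambda>S i j. if j \<in> S then p i j * (u i * v j) else 0"
  let ?L1 = "\<lambda>i j. c k1 l1 i j * (A i j - p i j)"
  let ?L2 = "\<lambda>i j. c k2 l2 i j * (A i j - p i j)"
  let ?L3 = "\<lambda>i j. c k3 l3 i j * (A i j - p i j)"
  let ?h = "\<lambda>i j. if i \<notin> H \<and> j \<notin> H \<and> w < u i * v j then A i j * (u i * v j) else 0"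
  let ?h' = "\<lambda>i j. if w < u i * v j then p i j * (u i * v j) else 0"
  have pointwise: "(A' i j - p i j) * (real_of_int (k i) * real_of_int (l j)) \<le>
      (?O i j + ?O' i j) + (?P H i j + ?P' H i j) + ?L1 i j +
      ((?L2 i j + ?P V0 i j) + (?L3 i j + ?P' V0 i j)) + (?h i j + ?h' i j)"
    if i: "i \<in> {1..n}" and j: "j \<in> {1..n}" for i j
  proof -
    define z where "z = real_of_int (k i) * real_of_int (l j)"
    define q where "q = u i * v j"
    have q0: "0 \<le> q" using uv by (simp add: q_def)
    have zq: "\<bar>z\<bar> = q" by (simp add: z_def q_def u_def v_def abs_mult)
    note bounds = A'(2,3)[OF i j] p(1)[OF i j] A0[OF i j]
    have pq: "0 \<le> p i j * q" "0 \<le> A' i j * q" "0 \<le> A i j * q" "A' i j * q \<le> A i j * q"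
      using bounds q0 by (auto intro: mult_right_mono)
    have zle: "x * z \<le> x * q" "- (x * z) \<le> x * q" if "0 \<le> x" for x
      using mult_left_mono[of z q x] mult_left_mono[of "- z" q x] zq that by (auto simp: abs_le_iff)
    \<comment> \<open>On heavy pairs the cutoff kills \<open>?L2\<close>, and only a harmless
      nonnegative mean term remains.\<close>
    have L2: "?L2 i j + ?P V0 i j = (if i \<in> V0 then if q \<le> w then A i j * q else p i j * q else 0)"
      using i j by (auto simp: c_def k2_def l2_def q_def u_def v_def algebra_simps abs_mult)
    have L3: "?L3 i j + ?P' V0 i j = (if j \<in> V0 then if q \<le> w then A i j * q else p i j * q else 0)"
      using i j by (auto simp: c_def k3_def l3_def q_def u_def v_def algebra_simps abs_mult)
    have L1: "?L1 i j = (if i \<in> H \<or> j \<in> H then 0 else if q \<le> w then z * (A i j - p i j) else 0)"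
      using i j w zq by (auto simp: c_def k1_def l1_def z_def)
    have nonneg: "0 \<le> ?O i j" "0 \<le> ?O' i j" "0 \<le> ?P H i j" "0 \<le> ?P' H i j"
        "0 \<le> ?L2 i j + ?P V0 i j" "0 \<le> ?L3 i j + ?P' V0 i j" "0 \<le> ?h i j" "0 \<le> ?h' i j"
      unfolding L2 L3 using pq by (auto simp: q_def mult.assoc)
    have main: "(A' i j - p i j) * z \<le> A' i j * q + p i j * q"
      using zle(1)[OF bounds(1)] zle(2)[OF bounds(3)] by (simp add: left_diff_distrib)
    consider "i \<in> H \<or> j \<in> H" | "i \<notin> H" "j \<notin> H" "q \<le> w" | "i \<notin> H" "j \<notin> H" "w < q" by linarith
    then have "(A' i j - p i j) * z \<le>
        (?O i j + ?O' i j) + (?P H i j + ?P' H i j) + ?L1 i j +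
        ((?L2 i j + ?P V0 i j) + (?L3 i j + ?P' V0 i j)) + (?h i j + ?h' i j)"
    proof cases
      case 1
      then have "(i, j) \<in> Q \<or> (j, i) \<in> Q" using Q(2) i j by blast
      then have "A' i j * q \<le> ?O i j + ?O' i j" using pq(2) by (auto simp: q_def mult.assoc)
      moreover have "p i j * q \<le> ?P H i j + ?P' H i j" using 1 pq(1) by (auto simp: q_def)
      moreover have "?L1 i j = 0" using 1 L1 by simp
      ultimately show ?thesis using main nonneg(5-8) by linarith
    next
      case 2
      have "(A' i j - p i j) * z - ?L1 i j = (A' i j - A i j) * z"
        using 2 L1 by (simp add: algebra_simps)
      also have "\<dots> \<le> (?L2 i j + ?P V0 i j) + (?L3 i j + ?P' V0 i j)"
      proof (cases "i \<in> V0 \<or> j \<in> V0")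
        case True
        have "(A' i j - A i j) * z = - ((A i j - A' i j) * z)" by (simp add: algebra_simps)
        also have "\<dots> \<le> (A i j - A' i j) * q" using bounds by (intro zle(2)) simp
        also have "\<dots> \<le> A i j * q" using pq by (simp add: left_diff_distrib)
        also have "\<dots> \<le> (?L2 i j + ?P V0 i j) + (?L3 i j + ?P' V0 i j)"
          unfolding L2 L3 using True 2 pq by auto
        finally show ?thesis .
      next
        case False
        then have "A' i j = A i j" using A'(4)[OF i j] by simp
        then show ?thesis using nonneg by simp
      qed
      finally show ?thesis using nonneg(1-4,7,8) by linarith
    next
      case 3
      have "A' i j * q \<le> ?h i j" using 3 pq by (auto simp: q_def)
      moreover have "p i j * q \<le> ?h' i j" using 3 pq by (auto simp: q_def)
      moreover have "?L1 i j = 0" using 3 L1 by simp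
      ultimately show ?thesis using main nonneg(1-6) by linarith
    qed
    then show ?thesis by (simp only: z_def)
  qed
  have "0 \<le> (\<Sum>j\<in>{1..n}. (A' 1 j)\<^sup>2)" by (intro sum_nonneg) auto
  also have "\<dots> \<le> D" using n by (intro D) auto
  finally have D0: "0 \<le> D" .
  have oriented: "(\<Sum>i\<in>{1..n}. \<Sum>j\<in>{1..n}. if (i, j) \<in> Q then A' i j * x i * y j else 0) \<le> 52 * n * r * sqrt D"
    if x: "\<And>i. 0 \<le> x i" "(\<Sum>i\<in>{1..n}. (x i)\<^sup>2) \<le> 4 * real n"
      and y: "\<And>i. 0 \<le> y i" "(\<Sum>i\<in>{1..n}. (y i)\<^sup>2) \<le> 4 * real n" for x y
  proof -
    have "(\<Sum>i\<in>{1..n}. (A' i j)\<^sup>2) \<le> D" if "j \<in> {1..n}" for j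
    proof -
      have "(\<Sum>i\<in>{1..n}. (A' i j)\<^sup>2) = (\<Sum>i\<in>{1..n}. (A' j i)\<^sup>2)"
        using A'(1) that by (intro sum.cong) auto
      then show ?thesis using D[OF that] by simp
    qed
    then have "(\<Sum>i\<in>{1..n}. \<Sum>j\<in>{1..n}. if (i, j) \<in> Q then A' i j * x i * y j else 0) \<le>
        sqrt (160 * r * (\<Sum>i\<in>{1..n}. (x i)\<^sup>2)) * sqrt (D * (\<Sum>i\<in>{1..n}. (y i)\<^sup>2))"
      using A' x y by (intro oriented_bilinear_le[OF _ A _ _ Q1]) auto
    also have "\<dots> \<le> sqrt ((13 * r)\<^sup>2 * (4 * real n)) * sqrt (D * (4 * real n))"
    proof (intro mult_mono real_sqrt_le_mono x y D0)
      \<comment> \<open>\<open>sqrt (160 r) <= 13 r\<close> because \<open>r >= 1\<close>; two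
        vectors of norm at most \<open>2 sqrt n\<close> turn 13 into 52.\<close>
      have "r * 1 \<le> r * r" using r by (intro mult_left_mono) auto
      then show "160 * r \<le> (13 * r)\<^sup>2" using r by (simp add: power2_eq_square)
    qed (use r D0 in \<open>auto intro!: sum_nonneg mult_nonneg_nonneg\<close>)
    also have "\<dots> = 52 * n * r * sqrt D"
      using r by (simp add: real_sqrt_mult)
    finally show ?thesis .
  qed
  have S1: "(\<Sum>i\<in>{1..n}. \<Sum>j\<in>{1..n}. ?O i j) \<le> 52 * n * r * sqrt D"
    by (rule oriented[OF uv(1) u2 uv(2) v2])
  have S1': "(\<Sum>i\<in>{1..n}. \<Sum>j\<in>{1..n}. ?O' i j) \<le> 52 * n * r * sqrt D"
  proof -
    have "(\<Sum>i\<in>{1..n}. \<Sum>j\<in>{1..n}. ?O' i j) = (\<Sum>j\<in>{1..n}. \<Sum>i\<in>{1..n}. ?O' i j)"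
      by (rule sum.swap)
    also have "\<dots> = (\<Sum>i\<in>{1..n}. \<Sum>j\<in>{1..n}. if (i, j) \<in> Q then A' i j * v i * u j else 0)"
      using A'(1) by (intro sum.cong) auto
    also have "\<dots> \<le> 52 * n * r * sqrt D" by (rule oriented[OF uv(2) v2 uv(1) u2])
    finally show ?thesis .
  qed
  have PS: "(\<Sum>i\<in>{1..n}. \<Sum>j\<in>{1..n}. ?P S i j) \<le> 4 * sqrt c * n * w"
      "(\<Sum>i\<in>{1..n}. \<Sum>j\<in>{1..n}. ?P' S i j) \<le> 4 * sqrt c * n * w"
    if S: "S \<subseteq> {1..n}" "card S * d \<le> c * n" for S and c :: real
  proof -
    show "(\<Sum>i\<in>{1..n}. \<Sum>j\<in>{1..n}. ?P S i j) \<le> 4 * sqrt c * n * w"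
      unfolding sum_if_subset[OF S(1)] w_def
      using d by (intro mean_sum_le[OF n _ p(2) S uv(1) u2 uv(2) v2]) auto
    have "(\<Sum>i\<in>{1..n}. \<Sum>j\<in>{1..n}. ?P' S i j) = (\<Sum>j\<in>{1..n}. \<Sum>i\<in>{1..n}. ?P' S i j)"
      by (rule sum.swap)
    also have "\<dots> = (\<Sum>i\<in>{1..n}. \<Sum>j\<in>{1..n}. if i \<in> S then p j i * (v i * u j) else 0)"
      by (intro sum.cong) auto
    also have "\<dots> \<le> 4 * sqrt c * n * w"
      unfolding sum_if_subset[OF S(1)] w_def
      using d by (intro mean_sum_le[OF n _ p(2) S uv(2) v2 uv(1) u2]) auto
    finally show "(\<Sum>i\<in>{1..n}. \<Sum>j\<in>{1..n}. ?P' S i j) \<le> 4 * sqrt c * n * w" .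
  qed
  have nw: "0 \<le> n * w" using w by simp
  have sqrt2: "4 * sqrt 2 * n * w \<le> 6 * (n * w)"
  proof -
    have "sqrt 2 \<le> 3 / 2" by (rule real_le_lsqrt) (auto simp: power2_eq_square)
    then show ?thesis using mult_right_mono[OF _ nw, of "4 * sqrt 2" 6] by (simp add: mult.assoc)
  qed
  have sqrt10: "4 * sqrt 10 * n * w \<le> 13 * (n * w)"
  proof -
    have "sqrt 10 \<le> 13 / 4" by (rule real_le_lsqrt) (auto simp: power2_eq_square)
    then show ?thesis using mult_right_mono[OF _ nw, of "4 * sqrt 10" 13] by (simp add: mult.assoc)
  qed
  have S6: "(\<Sum>i\<in>{1..n}. \<Sum>j\<in>{1..n}. ?h i j) \<le> 123520 * r * n * w"
  proof -
    let ?W = "{1..n} - H"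
    define un where "un i = nat \<bar>k i\<bar>" for i
    define vn where "vn i = nat \<bar>l i\<bar>" for i
    have unv: "real (un i) = u i" "real (vn i) = v i" for i by (auto simp: un_def vn_def u_def v_def)
    have "(\<Sum>i\<in>{1..n}. \<Sum>j\<in>{1..n}. ?h i j) = (\<Sum>i\<in>?W. \<Sum>j\<in>{1..n}. ?h i j)"
      by (intro sum.mono_neutral_right) auto
    also have "\<dots> = (\<Sum>i\<in>?W. \<Sum>j\<in>?W. if w < real (un i) * real (vn j)
        then A i j * (real (un i) * real (vn j)) else 0)"
      unfolding unv by (intro sum.cong refl sum.mono_neutral_cong_right) auto
    also have "\<dots> \<le> 123520 * r * n * w"
      unfolding w_def
    proof (rule heavy_sum_le[OF n d r disc A0 sym])
      have "(\<Sum>i\<in>?W. (u i)\<^sup>2) \<le> (\<Sum>i\<in>{1..n}. (u i)\<^sup>2)" by (intro sum_mono2) auto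
      then show "(\<Sum>i\<in>?W. (real (un i))\<^sup>2) \<le> 4 * real n" using u2 by (simp add: unv)
      have "(\<Sum>i\<in>?W. (v i)\<^sup>2) \<le> (\<Sum>i\<in>{1..n}. (v i)\<^sup>2)" by (intro sum_mono2) auto
      then show "(\<Sum>i\<in>?W. (real (vn i))\<^sup>2) \<le> 4 * real n" using v2 by (simp add: unv)
    qed (use H(2) in auto)
    finally show ?thesis .
  qed
  have S7: "(\<Sum>i\<in>{1..n}. \<Sum>j\<in>{1..n}. ?h' i j) \<le> 16 * (n * w)"
  proof -
    have "(\<Sum>i\<in>{1..n}. \<Sum>j\<in>{1..n}. ?h' i j) \<le>
        (\<Sum>i\<in>{1..n}. \<Sum>j\<in>{1..n}. d / n / w * ((u i)\<^sup>2 * (v j)\<^sup>2))"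
    proof (intro sum_mono)
      fix i j assume ij: "i \<in> {1..n}" "j \<in> {1..n}"
      define q where "q = u i * v j"
      have q0: "0 \<le> q" using uv by (simp add: q_def)
      have "(if w < q then p i j * q else 0) \<le> d / n * (q * q / w)"
      proof (cases "w < q")
        case True
        \<comment> \<open>Heaviness replaces \<open>q\<close> by \<open>q^2 / w\<close>, so the
          squared norms take over.\<close>
        have "q * w \<le> q * q" using True q0 by (intro mult_left_mono) auto
        then have "q \<le> q * q / w" using w by (simp add: pos_le_divide_eq)
        then have "p i j * q \<le> d / n * (q * q / w)"
          using p[OF ij] q0 d by (intro mult_mono) auto
        then show ?thesis using True by simp
      qed (use d w in auto)
      also have "d / n * (q * q / w) = d / n / w * ((u i)\<^sup>2 * (v j)\<^sup>2)"
        by (simp add: q_def power2_eq_square mult_ac)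
      finally show "?h' i j \<le> d / n / w * ((u i)\<^sup>2 * (v j)\<^sup>2)"
        by (simp only: q_def)
    qed
    also have "\<dots> = d / n / w * ((\<Sum>i\<in>{1..n}. (u i)\<^sup>2) * (\<Sum>j\<in>{1..n}. (v j)\<^sup>2))"
      by (subst sum_product) (simp add: sum_distrib_left)
    also have "\<dots> \<le> d / n / w * ((4 * real n) * (4 * real n))"
      using d w by (intro mult_left_mono mult_mono u2 v2 sum_nonneg) auto
    also have "\<dots> = 16 * (n * w)"
      using w n0 by (simp add: w(2)[symmetric])
    finally show ?thesis .
  qed
  have "(\<Sum>i\<in>{1..n}. \<Sum>j\<in>{1..n}. (A' i j - p i j) * (real_of_int (k i) * real_of_int (l j))) \<le>
      (\<Sum>i\<in>{1..n}. \<Sum>j\<in>{1..n}. (?O i j + ?O' i j) + (?P H i j + ?P' H i j) + ?L1 i j +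
        ((?L2 i j + ?P V0 i j) + (?L3 i j + ?P' V0 i j)) + (?h i j + ?h' i j))"
    by (intro sum_mono pointwise)
  also have "\<dots> = ((\<Sum>i\<in>{1..n}. \<Sum>j\<in>{1..n}. ?O i j) + (\<Sum>i\<in>{1..n}. \<Sum>j\<in>{1..n}. ?O' i j)) +
      ((\<Sum>i\<in>{1..n}. \<Sum>j\<in>{1..n}. ?P H i j) + (\<Sum>i\<in>{1..n}. \<Sum>j\<in>{1..n}. ?P' H i j)) +
      (\<Sum>i\<in>{1..n}. \<Sum>j\<in>{1..n}. ?L1 i j) +
      (((\<Sum>i\<in>{1..n}. \<Sum>j\<in>{1..n}. ?L2 i j) + (\<Sum>i\<in>{1..n}. \<Sum>j\<in>{1..n}. ?P V0 i j)) +
       ((\<Sum>i\<in>{1..n}. \<Sum>j\<in>{1..n}. ?L3 i j) + (\<Sum>i\<in>{1..n}. \<Sum>j\<in>{1..n}. ?P' V0 i j))) +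
      ((\<Sum>i\<in>{1..n}. \<Sum>j\<in>{1..n}. ?h i j) + (\<Sum>i\<in>{1..n}. \<Sum>j\<in>{1..n}. ?h' i j))"
    by (simp only: sum.distrib)
  \<comment> \<open>After \<open>1 <= r\<close>, the coefficient of \<open>n r sqrt d\<close> is 12
    + 240 + 26 + 123520 + 16 = 123814, and that of \<open>n r sqrt D\<close> is 52 + 52.\<close>
  also have "\<dots> \<le> (52 * n * r * sqrt D + 52 * n * r * sqrt D) + (6 * (n * w) + 6 * (n * w)) +
      80 * r * n * w + ((80 * r * n * w + 13 * (n * w)) + (80 * r * n * w + 13 * (n * w))) +
      (123520 * r * n * w + 16 * (n * w))"
    using V0 H
    by (intro add_mono S1 S1' lightD balls S6 S7 order_trans[OF PS(1) sqrt2] order_trans[OF PS(2) sqrt2]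
        order_trans[OF PS(1) sqrt10] order_trans[OF PS(2) sqrt10]) auto
  also have "\<dots> \<le> n * (123814 * r * w + 104 * r * sqrt D)"
  proof -
    have "1 * (n * w) \<le> r * (n * w)" using r nw by (intro mult_right_mono) auto
    then show ?thesis by (simp add: algebra_simps)
  qed
  finally show ?thesis by (simp add: w_def)
qed

section \<open>Concentration\<close>

lemma max_expected_degree_ge:
  assumes "i \<in> {1..n}" "j \<in> {1..n}"
  shows "real n * p i j \<le> max_expected_degree n p"
proof -
  have "finite {real n * p i j | i j. i \<in> {1..n} \<and> j \<in> {1..n}}"
    by (rule finite_image_set2) auto
  then show ?thesis unfolding max_expected_degree_def using assms by (intro Max_ge) auto
qed

lemma max_row_norm_sq_ge:
  assumes "i \<in> {1..n}"
  shows "(\<Sum>j\<in>{1..n}. (M i j)\<^sup>2) \<le> max_row_norm_sq n M"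
  unfolding max_row_norm_sq_def using assms by (intro Max_ge) auto

lemma max_row_norm_sq_le_max_degree:
  assumes "1 \<le> n" and "\<And>i j. i \<in> {1..n} \<Longrightarrow> j \<in> {1..n} \<Longrightarrow> 0 \<le> M i j \<and> M i j \<le> 1"
  shows "max_row_norm_sq n M \<le> max_degree n M"
proof -
  have "(\<Sum>j\<in>{1..n}. (M i j)\<^sup>2) \<le> max_degree n M" if i: "i \<in> {1..n}" for i
  proof -
    have "(\<Sum>j\<in>{1..n}. (M i j)\<^sup>2) \<le> (\<Sum>j\<in>{1..n}. M i j)"
    proof (rule sum_mono)
      fix j assume "j \<in> {1..n}"
      then have "M i j * M i j \<le> M i j * 1" using assms(2)[OF i] by (intro mult_left_mono) auto
      then show "(M i j)\<^sup>2 \<le> M i j" by (simp add: power2_eq_square)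
    qed
    also have "\<dots> \<le> max_degree n M"
      unfolding max_degree_def using i by (intro Max_ge) auto
    finally show ?thesis .
  qed
  then show ?thesis
    unfolding max_row_norm_sq_def using assms(1) by (intro Max.boundedI) auto
qed

lemma set_inhom_ER:
  assumes "A \<in> set_pmf (inhom_ER n p)"
  shows "A i j \<in> {0, 1}" "A i j = A j i"
proof -
  obtain E where "A = adj_matrix n E" using assms by (auto simp: inhom_ER_def)
  then show "A i j \<in> {0, 1}" "A i j = A j i"
    by (simp_all add: adj_matrix_sym) (simp add: adj_matrix_def)
qed

text \<open>Serves the degenerate case \<open>d = 0\<close>.\<close>

lemma set_inhom_ER_prob_0:
  assumes "edge_probs n p" "i \<in> {1..n}" "j \<in> {1..n}" "p i j = 0" "A \<in> set_pmf (inhom_ER n p)"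
  shows "A i j = 0"
proof -
  have "A i j \<in> set_pmf (map_pmf (\<lambda>A. A i j) (inhom_ER n p))" using assms(5) by simp
  then obtain b where "b \<in> set_pmf (bernoulli_pmf 0)" "A i j = of_bool b"
    unfolding inhom_ER_entry[OF assms(1-3)] by (auto simp: assms(4))
  moreover have "True \<notin> set_pmf (bernoulli_pmf 0)" by (simp add: set_pmf_iff)
  ultimately show ?thesis by (cases b) auto
qed

theorem theorem2p1:
  shows "\<exists>C::real. C > 0 \<and>
    (\<forall>(n::nat) (p :: nat \<Rightarrow> nat \<Rightarrow> real) (r::real).
      n \<ge> 1 \<longrightarrow> edge_probs n p \<longrightarrow> r \<ge> 1 \<longrightarrow>
      (let d = max_expected_degree n p in
       measure_pmf.prob (inhom_ER n p)
        {A. \<forall>V0 A'. V0 \<subseteq> {1..n} \<longrightarrow> real (card V0) * d \<le> 10 * real n \<longrightarrow>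
              reweighting n V0 A A' \<longrightarrow>
              spectral_norm n (\<lambda>i j. A' i j - mean_matrix (inhom_ER n p) i j)
                \<le> C * r powr (3/2) * (sqrt d + sqrt (max_degree n A')) \<and>
              spectral_norm n (\<lambda>i j. A' i j - mean_matrix (inhom_ER n p) i j)
                \<le> C * r powr (3/2) * (sqrt d + sqrt (max_row_norm_sq n A'))}
        \<ge> 1 - real n powr (- r)))"
proof (intro exI[of _ "123814::real"] conjI allI impI)
  fix n :: nat and p :: "nat \<Rightarrow> nat \<Rightarrow> real" and r :: real
  assume n: "n \<ge> 1" and p: "edge_probs n p" and r: "r \<ge> 1"
  define d where "d = max_expected_degree n p"
  let ?G = "inhom_ER n p" and ?C = "123814 * r powr (3 / 2)"
  let ?M = "\<lambda>A' i j. A' i j - mean_matrix ?G i j"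
  define good where "good = {A. \<forall>V0 A'. V0 \<subseteq> {1..n} \<longrightarrow> real (card V0) * d \<le> 10 * real n \<longrightarrow>
      reweighting n V0 A A' \<longrightarrow>
      spectral_norm n (?M A') \<le> ?C * (sqrt d + sqrt (max_degree n A')) \<and>
      spectral_norm n (?M A') \<le> ?C * (sqrt d + sqrt (max_row_norm_sq n A'))}"
  have n0: "0 < real n" using n by simp
  have p01: "0 \<le> p i j" "p i j \<le> d / n" if "i \<in> {1..n}" "j \<in> {1..n}" for i j
    using p that max_expected_degree_ge[OF that, of p] n0
    by (auto simp: edge_probs_def d_def pos_le_divide_eq mult.commute)
  have "0 \<le> real n * p 1 1" using p01(1)[of 1 1] n by simp
  also have "\<dots> \<le> d" unfolding d_def using n by (intro max_expected_degree_ge) auto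
  finally have d0: "0 \<le> d" .
  \<comment> \<open>The bilinear bound is linear in \<open>r\<close>, which \<open>r >= 1\<close>
    weakens to the power 3/2.\<close>
  have "r powr 1 \<le> r powr (3 / 2)" using r by (intro powr_mono) auto
  then have rC: "123814 * r \<le> ?C" using r by simp
  \<comment> \<open>The cases \<open>d = 0\<close> and \<open>d > 0\<close> differ only in how they
    supply \<open>bil\<close>; the passage to both norm bounds is shared.\<close>
  have goodI: "A \<in> good" if A: "A \<in> set_pmf ?G"
    and bil: "\<And>V0 A' D k l. V0 \<subseteq> {1..n} \<Longrightarrow> real (card V0) * d \<le> 10 * real n \<Longrightarrow> reweighting n V0 A A' \<Longrightarrow>
      (\<And>i. i \<in> {1..n} \<Longrightarrow> (\<Sum>j\<in>{1..n}. (A' i j)\<^sup>2) \<le> D) \<Longrightarrow>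
      k \<in> lattice_ball n \<Longrightarrow> l \<in> lattice_ball n \<Longrightarrow>
      (\<Sum>i\<in>{1..n}. \<Sum>j\<in>{1..n}. (A' i j - p i j) * (real_of_int (k i) * real_of_int (l j)))
        \<le> n * (123814 * r * sqrt d + 104 * r * sqrt D)" for A
    unfolding good_def mem_Collect_eq
  proof (intro allI impI)
    fix V0 A'
    assume V0: "V0 \<subseteq> {1..n}" "real (card V0) * d \<le> 10 * real n" and rw: "reweighting n V0 A A'"
    define D where "D = max_row_norm_sq n A'"
    have A': "0 \<le> A' i j \<and> A' i j \<le> 1" if "i \<in> {1..n}" "j \<in> {1..n}" for i j
    proof -
      have "0 \<le> A' i j" "A' i j \<le> A i j" using rw that unfolding reweighting_def by blast+
      then show ?thesis using set_inhom_ER(1)[OF A, of i j] by auto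
    qed
    have "0 \<le> (\<Sum>j\<in>{1..n}. (A' 1 j)\<^sup>2)" by (intro sum_nonneg) auto
    also have "\<dots> \<le> D" unfolding D_def using n by (intro max_row_norm_sq_ge) auto
    finally have D0: "0 \<le> D" .
    have "spectral_norm n (?M A') \<le> 123814 * r * sqrt d + 104 * r * sqrt D"
    proof (rule spectral_norm_le_lattice[OF n])
      fix k l assume kl: "k \<in> lattice_ball n" "l \<in> lattice_ball n"
      have "(\<Sum>i\<in>{1..n}. \<Sum>j\<in>{1..n}. ?M A' i j * (real_of_int (k i) * real_of_int (l j))) =
          (\<Sum>i\<in>{1..n}. \<Sum>j\<in>{1..n}. (A' i j - p i j) * (real_of_int (k i) * real_of_int (l j)))"
        by (intro sum.cong refl) (simp add: inhom_ER_mean[OF p])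
      also have "\<dots> \<le> n * (123814 * r * sqrt d + 104 * r * sqrt D)"
        unfolding D_def by (intro bil[OF V0 rw _ kl] max_row_norm_sq_ge)
      finally show "(\<Sum>i\<in>{1..n}. \<Sum>j\<in>{1..n}. ?M A' i j * (real_of_int (k i) * real_of_int (l j))) \<le>
          n * (123814 * r * sqrt d + 104 * r * sqrt D)" .
    qed
    also have "\<dots> \<le> 123814 * r * sqrt d + 123814 * r * sqrt D"
      using r D0 by (intro add_left_mono mult_right_mono) auto
    also have "\<dots> = 123814 * r * (sqrt d + sqrt D)" by (simp add: algebra_simps)
    also have "\<dots> \<le> ?C * (sqrt d + sqrt D)"
      using rC d0 D0 by (intro mult_right_mono) auto
    finally have row: "spectral_norm n (?M A') \<le> ?C * (sqrt d + sqrt D)" .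
    also have "\<dots> \<le> ?C * (sqrt d + sqrt (max_degree n A'))"
      using max_row_norm_sq_le_max_degree[OF n A'] r unfolding D_def
      by (intro mult_left_mono add_left_mono) auto
    finally show "spectral_norm n (?M A') \<le> ?C * (sqrt d + sqrt (max_degree n A')) \<and>
        spectral_norm n (?M A') \<le> ?C * (sqrt d + sqrt (max_row_norm_sq n A'))"
      using row by (simp add: D_def)
  qed
  have "1 - measure_pmf.prob ?G good = measure_pmf.prob ?G (- good)"
    using measure_pmf.prob_compl[of good ?G] by (simp add: Compl_eq_Diff_UNIV)
  also have "\<dots> \<le> real n powr (- r)"
  proof (cases "d = 0")
    case True
    \<comment> \<open>For \<open>d = 0\<close> the size condition on \<open>V0\<close> is void and
      the estimates above cannot divide by \<open>d\<close>, but \<open>A\<close> vanishes almost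
      surely, and \<open>A'\<close> with it.\<close>
    have "A \<in> good" if A: "A \<in> set_pmf ?G" for A
    proof (rule goodI[OF A])
      fix V0 A' D k l
      assume rw: "reweighting n V0 A A'"
        and D: "\<And>i. i \<in> {1..n} \<Longrightarrow> (\<Sum>j\<in>{1..n}. (A' i j)\<^sup>2) \<le> D"
      have "A' i j - p i j = 0" if ij: "i \<in> {1..n}" "j \<in> {1..n}" for i j
      proof -
        have "p i j = 0" using p01[OF ij] True by simp
        moreover have "A i j = 0" by (rule set_inhom_ER_prob_0[OF p ij \<open>p i j = 0\<close> A])
        moreover have "0 \<le> A' i j" "A' i j \<le> A i j" using rw ij unfolding reweighting_def by blast+
        ultimately show ?thesis by simp
      qed
      then have "(\<Sum>i\<in>{1..n}. \<Sum>j\<in>{1..n}. (A' i j - p i j) * (real_of_int (k i) * real_of_int (l j))) = 0"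
        by (intro sum.neutral ballI) simp
      moreover have "0 \<le> (\<Sum>j\<in>{1..n}. (A' 1 j)\<^sup>2)" by (intro sum_nonneg) auto
      moreover have "(\<Sum>j\<in>{1..n}. (A' 1 j)\<^sup>2) \<le> D" using n by (intro D) auto
      ultimately show "(\<Sum>i\<in>{1..n}. \<Sum>j\<in>{1..n}. (A' i j - p i j) * (real_of_int (k i) * real_of_int (l j)))
          \<le> n * (123814 * r * sqrt d + 104 * r * sqrt D)"
        using True r by simp
    qed
    then have "set_pmf ?G \<inter> (- good) = {}" by auto
    then show ?thesis by (simp add: measure_pmf_zero_iff[THEN iffD2])
  next
    case False
    then have d: "0 < d" using d0 by simp
    let ?B1 = "{A. \<not> discrepancy_bound n d r A}" and ?B2 = "{A. \<not> degree_sum_bound n d r A}"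
      and ?B3 = "{A. \<not> light_bound n d r p A}"
    \<comment> \<open>The restriction to the support supplies symmetry and entries 0 or 1.\<close>
    have "A \<in> good" if "A \<in> set_pmf ?G" "A \<notin> ?B1 \<union> ?B2 \<union> ?B3" for A
      using that by (intro goodI bilinear_le[OF n d r p01 _ _ _ _ _ _ _ _]) (auto dest: set_inhom_ER)
    then have "- good \<inter> set_pmf ?G \<subseteq> ?B1 \<union> ?B2 \<union> ?B3" by auto
    then have "measure_pmf.prob ?G (- good \<inter> set_pmf ?G) \<le> measure_pmf.prob ?G (?B1 \<union> ?B2 \<union> ?B3)"
      by (intro measure_pmf.finite_measure_mono) auto
    also have "\<dots> \<le> measure_pmf.prob ?G (?B1 \<union> ?B2) + measure_pmf.prob ?G ?B3"
      by (rule measure_Un_le) auto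
    also have "measure_pmf.prob ?G (?B1 \<union> ?B2) \<le> measure_pmf.prob ?G ?B1 + measure_pmf.prob ?G ?B2"
      by (rule measure_Un_le) auto
    also have "measure_pmf.prob ?G ?B1 + measure_pmf.prob ?G ?B2 + measure_pmf.prob ?G ?B3 \<le>
        real n powr (- r) / 4 + real n powr (- r) / 4 + real n powr (- r) / 4"
      using d by (intro add_mono prob_not_discrepancy_bound prob_not_degree_sum_bound
          prob_not_light_bound p n r p01) auto
    also have "\<dots> \<le> real n powr (- r)" by simp
    finally show ?thesis by (simp add: measure_Int_set_pmf)
  qed
  finally show "let d = max_expected_degree n p in measure_pmf.prob ?G
      {A. \<forall>V0 A'. V0 \<subseteq> {1..n} \<longrightarrow> real (card V0) * d \<le> 10 * real n \<longrightarrow>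
        reweighting n V0 A A' \<longrightarrow>
        spectral_norm n (?M A') \<le> ?C * (sqrt d + sqrt (max_degree n A')) \<and>
        spectral_norm n (?M A') \<le> ?C * (sqrt d + sqrt (max_row_norm_sq n A'))}
      \<ge> 1 - real n powr (- r)"
    unfolding Let_def good_def d_def by simp
qed simp

end
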